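(* Consider the orthogonal group synchronization model: let $O_1,\dots,O_n$ be independent Haar-uniform random matrices in $\mathsf O(d)=\{O\in\mathbb R^{d\times d}:O^{\top}O=\mathbb I_d\}$, let $U=(O_1,\dots,O_n)\in\mathbb R^{d\times nd}$, and observe $$Y=\frac{\lambda}{\sqrt n}U^{\top}U+Z,$$ that is, $d\times d$ blocks $Y_{i,j}=\frac{\lambda}{\sqrt n}O_i^{\top}O_j+Z_{i,j}$, where $Z$ is an $nd\times nd$ GOE matrix independent of $U$ and $\lambda>0$. Suppose that $d=n^{o(1)}$ and $\lambda<1-\delta$ for some constant $\delta>0$. Assume that the low-degree heuristic holds for the hidden informative sample problems associated with this model (see context). Then any algorithm which, given $Y$, outputs an estimator $\mathcal X$ achieving weak recovery of $\Theta=\frac{\lambda}{\sqrt n}U^{\top}U$, i.e. $\mathbb E\big[\langle\mathcal X,\Theta\rangle/(\|\mathcal X\|\,\|\Theta\|)\big]\ge c$ for some constant $c>0$, requires running time at least $\exp(n^{\Omega(1)})$.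
   Context: Asymptotic notation is with respect to $n\to\infty$; $x_n\ll y_n$ means $x_n/y_n\to0$. "Requires running time at least $\exp(n^{\Omega(1)})$" means no algorithm with running time $\exp(n^{o(1)})$ succeeds. A GOE matrix is symmetric with independent entries on and above the diagonal, $\mathcal N(0,1)$ off the diagonal and $\mathcal N(0,2)$ on it. Inner product and norm are Frobenius; the ratio in weak recovery is read as $0$ when its denominator vanishes. Low-degree heuristic. Let $P=P_n,Q=Q_n$ be probability measures on $\mathbb R^{N}$, $N=N_n$. For a degree $D=D_n$ put $\mathsf{Adv}_{\le D}(P;Q)=\sup_f \mathbb E_P[f]/\sqrt{\mathbb E_Q[f^2]}$, the supremum over real polynomials $f$ on $\mathbb R^N$ of degree at most $D$. A $\{0,1\}$-valued algorithm $\mathcal A$ achieves strong detection if $Q(\mathcal A=1)+P(\mathcal A=0)\to0$, and weak detection if this sum is at most $1-\epsilon$ for some fixed $\epsilon>0$. The low-degree heuristic holds for testing $P$ against $Q$ if: (1) whenever $\mathsf{Adv}_{\le D}(P;Q)=O(1)$ there is a constant $C$ such that no algorithm with running time $N^{D/(C\log N)}$ achieves strong detection; (2) whenever $\mathsf{Adv}_{\le D}(P;Q)=1+o(1)$ there is a constant $C$ such that no algorithm with running time $N^{D/(C\log N)}$ achieves weak detection. Hidden informative sample problem with base pair $(P,Q)$ and sample number $M=M_n$: test between $\overline Q$, the law of $(\mathsf Y_1,\dots,\mathsf Y_M)$ i.i.d. from $Q$, and $\overline P$, the law of $(\mathsf Y_1,\dots,\mathsf Y_M)$ where $\kappa$ is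 uniform on $\{1,\dots,M\}$ and, given $\kappa$, the $\mathsf Y_j$ are independent with $\mathsf Y_\kappa\sim P$ and $\mathsf Y_j\sim Q$ for $j\ne\kappa$ (dimension $MN$). The associated problems: the base pair is ($P$ = law of $Y$, $Q$ = law of $Z$), for any parameters $\lambda,d$ satisfying the assumptions of the claim (for some constant $\delta>0$); the sample number is any $M$ with $\Delta\ll M\le N\Delta$, where $\Delta>1$ is an upper bound for $\mathsf{Adv}_{\le D}(P;Q)^2$ and $N$ is the dimension of the base pair. The constant $C$ in the heuristic may be taken independent of the choice of $M$. *)

theory Defs
  imports "HOL-Probability.Probability"
begin

section \<open>Coordinates\<close>

text \<open>Points of \<open>\<real>\<^sup>N\<close> are extensional functions on \<open>{..<N}\<close>. Matrices, and sequences of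
  points, are stored row by row.\<close>

abbreviation real_space :: "nat \<Rightarrow> (nat \<Rightarrow> real) measure" where
  "real_space N \<equiv> PiM {..<N} (\<lambda>_. borel)"

definition row_major :: "nat \<Rightarrow> nat \<Rightarrow> (nat \<Rightarrow> nat \<Rightarrow> real) \<Rightarrow> nat \<Rightarrow> real" where
  "row_major r c A = (\<lambda>k\<in>{..<r * c}. A (k div c) (k mod c))"


section \<open>Randomized algorithms on real inputs\<close>

text \<open>
  The computational model is the real random access machine: real registers with exact
  arithmetic and comparisons at unit cost, natural-number index registers for addressing and
  loop control (no conversion between reals and naturals, in particular no rounding), and an
  instruction that draws a fresh standard Gaussian. Index subtraction is truncated, and
  \<open>x / 0 = 0\<close>.

  Instructions with suffix R operate on real registers, those with suffix I on index registers;
  the first operand is the destination, or in a jump the left-hand side of the comparison, and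
  the last operand of a jump is its target. \<open>Load i a\<close> sets real register \<open>i\<close> to the contents
  of the real register whose number is held in index register \<open>a\<close>; \<open>Store a i\<close> is the reverse.
\<close>

datatype instr =
    SetR nat real
  | AddR nat nat nat
  | SubR nat nat nat
  | MulR nat nat nat
  | DivR nat nat nat
  | Gauss nat
  | SetI nat nat
  | AddI nat nat nat
  | SubI nat nat nat
  | Load nat nat
  | Store nat nat
  | JumpLeR nat nat nat
  | JumpLeI nat nat nat

type_synonym program = "instr list"

text \<open>Program counter, index registers, real registers, number of Gaussians drawn so far.\<close>

datatype config =
  Config (pc: nat) (ireg: "nat \<Rightarrow> nat") (rreg: "nat \<Rightarrow> real") (drawn: nat)

text \<open>The first argument is the random tape.\<close>

fun exec_instr :: "(nat \<Rightarrow> real) \<Rightarrow> instr \<Rightarrow> config \<Rightarrow> config" where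
  "exec_instr w (SetR i c) (Config p a r t) = Config (Suc p) a (r(i := c)) t"
| "exec_instr w (AddR i j k) (Config p a r t) = Config (Suc p) a (r(i := r j + r k)) t"
| "exec_instr w (SubR i j k) (Config p a r t) = Config (Suc p) a (r(i := r j - r k)) t"
| "exec_instr w (MulR i j k) (Config p a r t) = Config (Suc p) a (r(i := r j * r k)) t"
| "exec_instr w (DivR i j k) (Config p a r t) = Config (Suc p) a (r(i := r j / r k)) t"
| "exec_instr w (Gauss i) (Config p a r t) = Config (Suc p) a (r(i := w t)) (Suc t)"
| "exec_instr w (SetI i m) (Config p a r t) = Config (Suc p) (a(i := m)) r t"
| "exec_instr w (AddI i j k) (Config p a r t) = Config (Suc p) (a(i := a j + a k)) r t"
| "exec_instr w (SubI i j k) (Config p a r t) = Config (Suc p) (a(i := a j - a k)) r t"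
| "exec_instr w (Load i j) (Config p a r t) = Config (Suc p) a (r(i := r (a j))) t"
| "exec_instr w (Store j i) (Config p a r t) = Config (Suc p) a (r(a j := r i)) t"
| "exec_instr w (JumpLeR i j q) (Config p a r t) =
     Config (if r i \<le> r j then q else Suc p) a r t"
| "exec_instr w (JumpLeI i j q) (Config p a r t) =
     Config (if a i \<le> a j then q else Suc p) a r t"

definition halted :: "program \<Rightarrow> config \<Rightarrow> bool" where
  "halted prog c \<longleftrightarrow> length prog \<le> pc c"

definition step :: "program \<Rightarrow> (nat \<Rightarrow> real) \<Rightarrow> config \<Rightarrow> config" where
  "step prog w c = (if halted prog c then c else exec_instr w (prog ! pc c) c)"

definition initial :: "nat \<Rightarrow> (nat \<Rightarrow> real) \<Rightarrow> config" where
  "initial N x = Config 0 (\<lambda>_. 0) (\<lambda>i. if i < N then x i else 0) 0"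

definition halts_within :: "nat \<Rightarrow> program \<Rightarrow> (nat \<Rightarrow> real) \<Rightarrow> (nat \<Rightarrow> real) \<Rightarrow> nat \<Rightarrow> bool" where
  "halts_within N prog x w s \<longleftrightarrow> halted prog ((step prog w ^^ s) (initial N x))"

text \<open>Real registers on termination.\<close>

definition final :: "nat \<Rightarrow> program \<Rightarrow> (nat \<Rightarrow> real) \<Rightarrow> (nat \<Rightarrow> real) \<Rightarrow> nat \<Rightarrow> real" where
  "final N prog x w =
     rreg ((step prog w ^^ (LEAST s. halts_within N prog x w s)) (initial N x))"

text \<open>
  An algorithm for a sequence of problems is a sequence of programs, one for each \<open>n\<close>, since the
  parameters of the \<open>n\<close>-th problem are known to it. To keep this from hiding work in the
  program text, the running time bounds the length of the program as well as the number of steps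
  (on every input and every random tape).
\<close>

definition runs_in_time :: "nat \<Rightarrow> program \<Rightarrow> real \<Rightarrow> bool" where
  "runs_in_time N prog T \<longleftrightarrow>
     real (length prog) \<le> T \<and> (\<forall>x w. \<exists>s. real s \<le> T \<and> halts_within N prog x w s)"

definition tape :: "(nat \<Rightarrow> real) measure" where
  "tape = PiM UNIV (\<lambda>_. density lborel std_normal_density)"

text \<open>A \<open>{0,1}\<close>-valued algorithm outputs 1 iff its real register 0 is positive on termination.\<close>

definition accepts :: "nat \<Rightarrow> program \<Rightarrow> (nat \<Rightarrow> real) \<Rightarrow> (nat \<Rightarrow> real) \<Rightarrow> bool" where
  "accepts N prog x w \<longleftrightarrow> final N prog x w 0 > 0"


section \<open>Detection and the low-degree heuristic\<close>

definition testing_error ::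
    "nat \<Rightarrow> (nat \<Rightarrow> real) measure \<Rightarrow> (nat \<Rightarrow> real) measure \<Rightarrow> program \<Rightarrow> real" where
  "testing_error N P Q prog =
     measure (Q \<Otimes>\<^sub>M tape) {(x, w) \<in> space (Q \<Otimes>\<^sub>M tape). accepts N prog x w} +
     measure (P \<Otimes>\<^sub>M tape) {(x, w) \<in> space (P \<Otimes>\<^sub>M tape). \<not> accepts N prog x w}"

definition strong_detection ::
    "(nat \<Rightarrow> nat) \<Rightarrow> (nat \<Rightarrow> (nat \<Rightarrow> real) measure) \<Rightarrow> (nat \<Rightarrow> (nat \<Rightarrow> real) measure) \<Rightarrow>
     (nat \<Rightarrow> program) \<Rightarrow> bool" where
  "strong_detection N P Q A \<longleftrightarrow> (\<lambda>n. testing_error (N n) (P n) (Q n) (A n)) \<longlonglongrightarrow> 0"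

definition weak_detection ::
    "(nat \<Rightarrow> nat) \<Rightarrow> (nat \<Rightarrow> (nat \<Rightarrow> real) measure) \<Rightarrow> (nat \<Rightarrow> (nat \<Rightarrow> real) measure) \<Rightarrow>
     (nat \<Rightarrow> program) \<Rightarrow> bool" where
  "weak_detection N P Q A \<longleftrightarrow>
     (\<exists>\<epsilon>>0. \<forall>\<^sub>F n in sequentially. testing_error (N n) (P n) (Q n) (A n) \<le> 1 - \<epsilon>)"

definition exponents :: "nat \<Rightarrow> nat \<Rightarrow> (nat \<Rightarrow> nat) set" where
  "exponents N D = {a. (\<forall>i\<ge>N. a i = 0) \<and> (\<Sum>i<N. a i) \<le> D}"

definition polynomials :: "nat \<Rightarrow> nat \<Rightarrow> ((nat \<Rightarrow> real) \<Rightarrow> real) set" where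
  "polynomials N D = {\<lambda>x. \<Sum>a\<in>exponents N D. c a * (\<Prod>i<N. x i ^ a i) | c. True}"

text \<open>
  The supremum is extended-real valued; extended-real division gives the ratio its intended value
  when \<open>f\<close> vanishes \<open>Q\<close>-almost surely, namely \<open>0 / 0 = 0\<close> and \<open>\<infinity>\<close> for a positive numerator.
  The integrability conditions only matter for measures lacking moments, where the Bochner
  integral would default to 0.
\<close>

definition Adv ::
    "nat \<Rightarrow> nat \<Rightarrow> (nat \<Rightarrow> real) measure \<Rightarrow> (nat \<Rightarrow> real) measure \<Rightarrow> ereal" where
  "Adv N D P Q =
     (SUP f \<in> {f \<in> polynomials N D. integrable P f \<and> integrable Q (\<lambda>x. (f x)\<^sup>2)}.
        ereal (\<integral>x. f x \<partial>P) / ereal (sqrt (\<integral>x. (f x)\<^sup>2 \<partial>Q)))"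

text \<open>
  The heuristic for a whole family of testing problems, indexed by \<open>k \<in> K\<close>, with constants \<open>C\<close>
  that do not depend on \<open>k\<close>. For a singleton \<open>K\<close> this is the heuristic for one problem.
\<close>

definition low_degree_heuristic ::
    "'k set \<Rightarrow> ('k \<Rightarrow> nat \<Rightarrow> nat) \<Rightarrow> ('k \<Rightarrow> nat \<Rightarrow> (nat \<Rightarrow> real) measure) \<Rightarrow>
     ('k \<Rightarrow> nat \<Rightarrow> (nat \<Rightarrow> real) measure) \<Rightarrow> bool" where
  "low_degree_heuristic K N P Q \<longleftrightarrow> (\<forall>D :: nat \<Rightarrow> nat.
     (\<exists>C>0. \<forall>k\<in>K.
        (\<exists>B::real. \<forall>\<^sub>F n in sequentially. Adv (N k n) (D n) (P k n) (Q k n) \<le> ereal B) \<longrightarrow>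
        (\<nexists>A. (\<forall>\<^sub>F n in sequentially.
                runs_in_time (N k n) (A n)
                  (real (N k n) powr (real (D n) / (C * ln (real (N k n)))))) \<and>
              strong_detection (N k) (P k) (Q k) A)) \<and>
     (\<exists>C>0. \<forall>k\<in>K.
        (\<lambda>n. Adv (N k n) (D n) (P k n) (Q k n)) \<longlonglongrightarrow> 1 \<longrightarrow>
        (\<nexists>A. (\<forall>\<^sub>F n in sequentially.
                runs_in_time (N k n) (A n)
                  (real (N k n) powr (real (D n) / (C * ln (real (N k n)))))) \<and>
              weak_detection (N k) (P k) (Q k) A)))"


section \<open>Hidden informative samples\<close>

definition hidden_null :: "nat \<Rightarrow> nat \<Rightarrow> (nat \<Rightarrow> real) measure \<Rightarrow> (nat \<Rightarrow> real) measure" where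
  "hidden_null M N Q = distr (PiM {..<M} (\<lambda>_. Q)) (real_space (M * N)) (row_major M N)"

definition hidden_planted ::
    "nat \<Rightarrow> nat \<Rightarrow> (nat \<Rightarrow> real) measure \<Rightarrow> (nat \<Rightarrow> real) measure \<Rightarrow> (nat \<Rightarrow> real) measure" where
  "hidden_planted M N P Q =
     measure_pmf (pmf_of_set {..<M}) \<bind>
       (\<lambda>\<kappa>. distr (PiM {..<M} (\<lambda>j. if j = \<kappa> then P else Q))
               (real_space (M * N)) (row_major M N))"

definition sample_numbers :: "(nat \<Rightarrow> nat) \<Rightarrow> (nat \<Rightarrow> real) \<Rightarrow> (nat \<Rightarrow> nat) set" where
  "sample_numbers N \<Delta> =
     {M. (\<lambda>n. \<Delta> n / real (M n)) \<longlonglongrightarrow> 0 \<and>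
         (\<forall>\<^sub>F n in sequentially. 0 < M n \<and> real (M n) \<le> real (N n) * \<Delta> n)}"

definition hidden_sample_heuristic ::
    "(nat \<Rightarrow> nat) \<Rightarrow> (nat \<Rightarrow> (nat \<Rightarrow> real) measure) \<Rightarrow> (nat \<Rightarrow> (nat \<Rightarrow> real) measure) \<Rightarrow> bool" where
  "hidden_sample_heuristic N P Q \<longleftrightarrow>
     (\<forall>(D :: nat \<Rightarrow> nat) (\<Delta> :: nat \<Rightarrow> real).
        (\<forall>\<^sub>F n in sequentially. \<Delta> n > 1 \<and> (Adv (N n) (D n) (P n) (Q n))\<^sup>2 \<le> ereal (\<Delta> n)) \<longrightarrow>
        low_degree_heuristic (sample_numbers N \<Delta>)
          (\<lambda>M n. M n * N n)
          (\<lambda>M n. hidden_planted (M n) (N n) (P n) (Q n))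
          (\<lambda>M n. hidden_null (M n) (N n) (Q n)))"


section \<open>Orthogonal group synchronization\<close>

type_synonym matrix = "nat \<times> nat \<Rightarrow> real"

definition orthogonal_group :: "nat \<Rightarrow> matrix set" where
  "orthogonal_group d =
     {A \<in> extensional ({..<d} \<times> {..<d}).
        \<forall>a<d. \<forall>b<d. (\<Sum>c<d. A (c, a) * A (c, b)) = (if a = b then 1 else 0)}"

definition mat_mult :: "nat \<Rightarrow> matrix \<Rightarrow> matrix \<Rightarrow> matrix" where
  "mat_mult d A B = (\<lambda>(a, b)\<in>{..<d} \<times> {..<d}. \<Sum>c<d. A (a, c) * B (c, b))"

text \<open>Left-invariant Borel probability measures carried by \<open>O(d)\<close>: there is exactly one.\<close>

definition haar_orthogonal :: "nat \<Rightarrow> matrix measure \<Rightarrow> bool" where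
  "haar_orthogonal d \<mu> \<longleftrightarrow>
     prob_space \<mu> \<and>
     sets \<mu> = sets (PiM ({..<d} \<times> {..<d}) (\<lambda>_. borel)) \<and>
     (AE A in \<mu>. A \<in> orthogonal_group d) \<and>
     (\<forall>A\<in>orthogonal_group d. distr \<mu> \<mu> (mat_mult d A) = \<mu>)"

text \<open>The independent entries of an \<open>m \<times> m\<close> GOE matrix are those on and above the diagonal.\<close>

definition goe_entries :: "nat \<Rightarrow> matrix measure" where
  "goe_entries m =
     PiM {(p, q). p \<le> q \<and> q < m}
       (\<lambda>(p, q). density lborel (normal_density 0 (if p = q then sqrt 2 else 1)))"

definition noise :: "nat \<Rightarrow> matrix \<Rightarrow> nat \<Rightarrow> real" where
  "noise m g = row_major m m (\<lambda>p q. g (min p q, max p q))"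

text \<open>Entry \<open>(c, p)\<close> of \<open>U = (O\<^sub>1, \<dots>, O\<^sub>n)\<close>; here \<open>V i\<close> is the \<open>i\<close>-th block, counted from 0.\<close>

definition stacked :: "nat \<Rightarrow> (nat \<Rightarrow> matrix) \<Rightarrow> nat \<Rightarrow> nat \<Rightarrow> real" where
  "stacked d V c p = V (p div d) (c, p mod d)"

definition signal :: "nat \<Rightarrow> nat \<Rightarrow> real \<Rightarrow> (nat \<Rightarrow> matrix) \<Rightarrow> nat \<Rightarrow> real" where
  "signal n d l V =
     row_major (n * d) (n * d)
       (\<lambda>p q. l / sqrt (real n) * (\<Sum>c<d. stacked d V c p * stacked d V c q))"

definition sync_dim :: "nat \<Rightarrow> nat \<Rightarrow> nat" where
  "sync_dim n d = (n * d) * (n * d)"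

definition sync_space :: "(nat \<Rightarrow> matrix measure) \<Rightarrow> nat \<Rightarrow> nat \<Rightarrow> ((nat \<Rightarrow> matrix) \<times> matrix) measure" where
  "sync_space H n d = PiM {..<n} (\<lambda>_. H d) \<Otimes>\<^sub>M goe_entries (n * d)"

definition observation ::
    "nat \<Rightarrow> nat \<Rightarrow> real \<Rightarrow> (nat \<Rightarrow> matrix) \<Rightarrow> matrix \<Rightarrow> nat \<Rightarrow> real" where
  "observation n d l V g = (\<lambda>k\<in>{..<sync_dim n d}. signal n d l V k + noise (n * d) g k)"

definition planted_law ::
    "(nat \<Rightarrow> matrix measure) \<Rightarrow> nat \<Rightarrow> nat \<Rightarrow> real \<Rightarrow> (nat \<Rightarrow> real) measure" where
  "planted_law H n d l =
     distr (sync_space H n d) (real_space (sync_dim n d)) (\<lambda>(V, g). observation n d l V g)"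

definition null_law :: "nat \<Rightarrow> nat \<Rightarrow> (nat \<Rightarrow> real) measure" where
  "null_law n d = distr (goe_entries (n * d)) (real_space (sync_dim n d)) (noise (n * d))"

definition admissible :: "(nat \<Rightarrow> nat) \<Rightarrow> (nat \<Rightarrow> real) \<Rightarrow> bool" where
  "admissible d l \<longleftrightarrow>
     (\<forall>n. 1 \<le> d n) \<and>
     (\<exists>\<epsilon>. \<epsilon> \<longlonglongrightarrow> 0 \<and> (\<forall>\<^sub>F n in sequentially. real (d n) = real n powr \<epsilon> n)) \<and>
     (\<forall>n. 0 < l n) \<and>
     (\<exists>\<delta>>0. \<forall>n. l n < 1 - \<delta>)"

text \<open>\<open>\<langle>X, T\<rangle> / (\<parallel>X\<parallel> \<parallel>T\<parallel>)\<close>, which is 0 when the denominator vanishes.\<close>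

definition cosine :: "nat \<Rightarrow> (nat \<Rightarrow> real) \<Rightarrow> (nat \<Rightarrow> real) \<Rightarrow> real" where
  "cosine N X T =
     (\<Sum>k<N. X k * T k) / (sqrt (\<Sum>k<N. (X k)\<^sup>2) * sqrt (\<Sum>k<N. (T k)\<^sup>2))"

text \<open>
  The estimator is read off the first \<open>(nd)\<^sup>2\<close> real registers on termination. The expectation is
  over \<open>U\<close>, \<open>Z\<close> and the random tape.
\<close>

definition weak_recovery ::
    "(nat \<Rightarrow> matrix measure) \<Rightarrow> (nat \<Rightarrow> nat) \<Rightarrow> (nat \<Rightarrow> real) \<Rightarrow> (nat \<Rightarrow> program) \<Rightarrow> bool" where
  "weak_recovery H d l A \<longleftrightarrow>
     (\<exists>c>0. \<forall>\<^sub>F n in sequentially.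
        (\<integral>((V, g), w).
            cosine (sync_dim n (d n))
              (final (sync_dim n (d n)) (A n) (observation n (d n) (l n) V g) w)
              (signal n (d n) (l n) V)
          \<partial>(sync_space H n (d n) \<Otimes>\<^sub>M tape)) \<ge> c)"

end

theory Submission
  imports Defs
begin

text \<open>
  For \<open>\<lambda>\<close> bounded away from 1 and \<open>d \<ll> n\<close>, weak recovery fails already for information-theoretic
  reasons. Suppose that an estimator \<open>u\<close> of norm at most 1 has overlap \<open>c \<parallel>\<Theta>\<parallel> = c \<lambda> \<surd>(n d)\<close> with
  \<open>\<Theta>\<close>. Since \<open>\<lambda>\<close> stays below 1, one may grant a second, independent observation
  \<open>s \<Theta> + z\<close> with \<open>z\<close> standard Gaussian and \<open>r = \<lambda>\<^sup>2 (1 + 2 s\<^sup>2) < 1\<close>. By Jensen's inequality the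
  statistic \<open>exp (t \<langle>u, \<cdot>\<rangle>)\<close> of the pair has expectation at least \<open>exp (t s c \<parallel>\<Theta>\<parallel>)\<close> under the
  planted law. Under the null law its second moment is at most \<open>exp (2 t\<^sup>2)\<close>, and the likelihood
  ratio of the pair has second moment at most \<open>(1 - r) powr (- d\<^sup>2 / 2)\<close>. The Cauchy--Schwarz
  inequality with \<open>t\<close> of order \<open>\<surd>(n d)\<close> then gives \<open>n d = O(d\<^sup>2)\<close>, contradicting \<open>d = n\<^bsup>o(1)\<^esup>\<close>.
\<close>

section \<open>Measurability of programs\<close>

text \<open>The datatype \<open>config\<close> carries no sigma-algebra, so measurability is imposed
  on its components, register by register.\<close>

definition measurable_config :: "'a measure \<Rightarrow> ('a \<Rightarrow> config) \<Rightarrow> bool" where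
  "measurable_config M c \<longleftrightarrow>
     (\<lambda>\<omega>. pc (c \<omega>)) \<in> measurable M (count_space UNIV) \<and>
     (\<lambda>\<omega>. drawn (c \<omega>)) \<in> measurable M (count_space UNIV) \<and>
     (\<forall>i. (\<lambda>\<omega>. ireg (c \<omega>) i) \<in> measurable M (count_space UNIV)) \<and>
     (\<forall>i. (\<lambda>\<omega>. rreg (c \<omega>) i) \<in> borel_measurable M)"

text \<open>A configuration depending on \<omega> has no fixed constructor form. With selectors, a
  case split on the deterministic instruction alone suffices.\<close>

lemma exec_instr_sel:
  "pc (exec_instr w ins c) =
     (case ins of JumpLeR i j q \<Rightarrow> if rreg c i \<le> rreg c j then q else Suc (pc c)
      | JumpLeI i j q \<Rightarrow> if ireg c i \<le> ireg c j then q else Suc (pc c)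
      | _ \<Rightarrow> Suc (pc c))"
  "drawn (exec_instr w ins c) = (case ins of Gauss i \<Rightarrow> Suc (drawn c) | _ \<Rightarrow> drawn c)"
  "ireg (exec_instr w ins c) k =
     (case ins of SetI i m \<Rightarrow> if k = i then m else ireg c k
      | AddI i j l \<Rightarrow> if k = i then ireg c j + ireg c l else ireg c k
      | SubI i j l \<Rightarrow> if k = i then ireg c j - ireg c l else ireg c k
      | _ \<Rightarrow> ireg c k)"
  "rreg (exec_instr w ins c) k =
     (case ins of SetR i x \<Rightarrow> if k = i then x else rreg c k
      | AddR i j l \<Rightarrow> if k = i then rreg c j + rreg c l else rreg c k
      | SubR i j l \<Rightarrow> if k = i then rreg c j - rreg c l else rreg c k
      | MulR i j l \<Rightarrow> if k = i then rreg c j * rreg c l else rreg c k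
      | DivR i j l \<Rightarrow> if k = i then rreg c j / rreg c l else rreg c k
      | Gauss i \<Rightarrow> if k = i then w (drawn c) else rreg c k
      | Load i j \<Rightarrow> if k = i then rreg c (ireg c j) else rreg c k
      | Store j i \<Rightarrow> if k = ireg c j then rreg c i else rreg c k
      | _ \<Rightarrow> rreg c k)"
  by (cases c; cases ins; simp)+

lemma measurable_config_exec_instr:
  assumes c: "measurable_config M c" and W: "\<And>k. (\<lambda>\<omega>. W \<omega> k) \<in> borel_measurable M"
  shows "measurable_config M (\<lambda>\<omega>. exec_instr (W \<omega>) ins (c \<omega>))"
proof -
  note W[measurable]
  have [measurable]: "(\<lambda>\<omega>. pc (c \<omega>)) \<in> measurable M (count_space UNIV)"
    "(\<lambda>\<omega>. drawn (c \<omega>)) \<in> measurable M (count_space UNIV)"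
    "\<And>i. (\<lambda>\<omega>. ireg (c \<omega>) i) \<in> measurable M (count_space UNIV)"
    "\<And>i. (\<lambda>\<omega>. rreg (c \<omega>) i) \<in> borel_measurable M"
    using c by (auto simp: measurable_config_def)
  \<comment> \<open>The register number is itself random but takes countably many values, so
    measurability for each fixed number is enough. The tape position and the comparison of index
    registers are handled likewise.\<close>
  have [measurable]: "(\<lambda>\<omega>. rreg (c \<omega>) (ireg (c \<omega>) j)) \<in> borel_measurable M" for j
    by (rule measurable_compose_countable[where f="\<lambda>i \<omega>. rreg (c \<omega>) i"]) measurable
  have [measurable]: "(\<lambda>\<omega>. W \<omega> (drawn (c \<omega>))) \<in> borel_measurable M"
    by (rule measurable_compose_countable[where f="\<lambda>i \<omega>. W \<omega> i"]) measurable
  have [measurable]: "Measurable.pred M (\<lambda>\<omega>. ireg (c \<omega>) i \<le> ireg (c \<omega>) j)" for i j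
  proof -
    have [measurable]: "Measurable.pred M (\<lambda>\<omega>. m \<le> ireg (c \<omega>) j)" for m
      by (rule measurable_compose[where f="\<lambda>\<omega>. ireg (c \<omega>) j" and N="count_space UNIV"]) auto
    show ?thesis
      by (rule measurable_compose_countable[where f="\<lambda>m \<omega>. m \<le> ireg (c \<omega>) j"]) measurable
  qed
  have "(\<lambda>\<omega>. pc (exec_instr (W \<omega>) ins (c \<omega>))) \<in> measurable M (count_space UNIV)"
    unfolding exec_instr_sel by (cases ins; simp)
  moreover have "(\<lambda>\<omega>. drawn (exec_instr (W \<omega>) ins (c \<omega>))) \<in> measurable M (count_space UNIV)"
    unfolding exec_instr_sel by (cases ins; simp)
  moreover have "(\<lambda>\<omega>. ireg (exec_instr (W \<omega>) ins (c \<omega>)) k) \<in> measurable M (count_space UNIV)" for k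
    unfolding exec_instr_sel by (cases ins; simp)
  moreover have "(\<lambda>\<omega>. rreg (exec_instr (W \<omega>) ins (c \<omega>)) k) \<in> borel_measurable M" for k
    unfolding exec_instr_sel by (cases ins; simp)
  ultimately show ?thesis
    unfolding measurable_config_def by blast
qed

lemma measurable_config_step:
  assumes c: "measurable_config M c" and W: "\<And>k. (\<lambda>\<omega>. W \<omega> k) \<in> borel_measurable M"
  shows "measurable_config M (\<lambda>\<omega>. step prog (W \<omega>) (c \<omega>))"
proof -
  have pc [measurable]: "(\<lambda>\<omega>. pc (c \<omega>)) \<in> measurable M (count_space UNIV)"
    using c by (auto simp: measurable_config_def)
  \<comment> \<open>One statement serves all four components, with \<open>F\<close> a selector. The
    current instruction is random only through the program counter, which has countably many
    values.\<close>
  have sel: "(\<lambda>\<omega>. F (step prog (W \<omega>) (c \<omega>))) \<in> measurable M N"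
    if 1: "(\<lambda>\<omega>. F (c \<omega>)) \<in> measurable M N"
    and 2: "\<And>ins. (\<lambda>\<omega>. F (exec_instr (W \<omega>) ins (c \<omega>))) \<in> measurable M N"
    for F :: "config \<Rightarrow> 'b" and N
  proof -
    note 1[measurable] 2[measurable]
    have [measurable]: "(\<lambda>\<omega>. F (exec_instr (W \<omega>) (prog ! pc (c \<omega>)) (c \<omega>))) \<in> measurable M N"
      by (rule measurable_compose_countable
            [where f="\<lambda>p \<omega>. F (exec_instr (W \<omega>) (prog ! p) (c \<omega>))"]) measurable
    have "(\<lambda>\<omega>. if length prog \<le> pc (c \<omega>) then F (c \<omega>)
             else F (exec_instr (W \<omega>) (prog ! pc (c \<omega>)) (c \<omega>))) \<in> measurable M N"
      by measurable
    then show ?thesis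
      by (simp add: step_def halted_def if_distrib[of F])
  qed
  show ?thesis
    using c measurable_config_exec_instr[OF c W]
    unfolding measurable_config_def by (intro conjI allI sel) auto
qed

lemma measurable_config_iterate:
  assumes X: "\<And>k. k < N \<Longrightarrow> (\<lambda>\<omega>. X \<omega> k) \<in> borel_measurable M"
    and W: "\<And>k. (\<lambda>\<omega>. W \<omega> k) \<in> borel_measurable M"
  shows "measurable_config M (\<lambda>\<omega>. (step prog (W \<omega>) ^^ s) (initial N (X \<omega>)))"
proof (induction s)
  case 0
  have "(\<lambda>\<omega>. if i < N then X \<omega> i else 0) \<in> borel_measurable M" for i
    using X by (cases "i < N") auto
  then show ?case
    by (simp add: measurable_config_def initial_def)
next
  case (Suc s)
  then show ?case
    using measurable_config_step[OF _ W] by simp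
qed

text \<open>The halting time is a measurable natural number, so the output is pieced together from
  countably many fixed iterates. On runs that never halt \<open>LEAST\<close> yields one default
  value, which keeps the halting time measurable.\<close>

lemma borel_measurable_final:
  assumes X: "\<And>k. k < N \<Longrightarrow> (\<lambda>\<omega>. X \<omega> k) \<in> borel_measurable M"
    and W: "\<And>k. (\<lambda>\<omega>. W \<omega> k) \<in> borel_measurable M"
  shows "(\<lambda>\<omega>. final N prog (X \<omega>) (W \<omega>) k) \<in> borel_measurable M"
proof -
  have meas: "measurable_config M (\<lambda>\<omega>. (step prog (W \<omega>) ^^ s) (initial N (X \<omega>)))" for s
    using X W by (rule measurable_config_iterate)
  have [measurable]: "(\<lambda>\<omega>. pc ((step prog (W \<omega>) ^^ s) (initial N (X \<omega>)))) \<in> measurable M (count_space UNIV)"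
    "(\<lambda>\<omega>. rreg ((step prog (W \<omega>) ^^ s) (initial N (X \<omega>))) k) \<in> borel_measurable M" for s
    using meas[of s] by (auto simp: measurable_config_def)
  have "(\<lambda>\<omega>. halts_within N prog (X \<omega>) (W \<omega>) s) \<in> measurable M (count_space UNIV)" for s
    unfolding halts_within_def halted_def by measurable
  then have [measurable]: "(\<lambda>\<omega>. LEAST s. halts_within N prog (X \<omega>) (W \<omega>) s) \<in> measurable M (count_space UNIV)"
    by (rule measurable_Least)
  show ?thesis
    unfolding final_def
    by (rule measurable_compose_countable
          [where f="\<lambda>s \<omega>. rreg ((step prog (W \<omega>) ^^ s) (initial N (X \<omega>))) k"]) measurable
qed

section \<open>Gaussian integrals\<close>

abbreviation gaussian :: "real \<Rightarrow> real measure" where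
  "gaussian \<sigma> \<equiv> density lborel (normal_density 0 \<sigma>)"

lemma nn_integral_normal_density:
  assumes "0 < \<sigma>"
  shows "(\<integral>\<^sup>+x. ennreal (normal_density \<mu> \<sigma> x) \<partial>lborel) = 1"
proof -
  interpret prob_space "density lborel (normal_density \<mu> \<sigma>)"
    using assms by (rule prob_space_normal_density)
  show ?thesis
    using emeasure_space_1 by (simp add: emeasure_density)
qed

text \<open>Completing the square: the factor is the one-dimensional Cameron-Martin density.\<close>

lemma normal_density_shift:
  assumes "0 < \<sigma>"
  shows "normal_density h \<sigma> x = normal_density 0 \<sigma> x * exp (h * x / \<sigma>\<^sup>2 - h\<^sup>2 / (2 * \<sigma>\<^sup>2))"
proof -
  have "- (x - h)\<^sup>2 / (2 * \<sigma>\<^sup>2) = - x\<^sup>2 / (2 * \<sigma>\<^sup>2) + (h * x / \<sigma>\<^sup>2 - h\<^sup>2 / (2 * \<sigma>\<^sup>2))"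
    using assms by (simp add: power2_eq_square field_simps)
  then show ?thesis
    by (simp only: normal_density_def exp_add mult.assoc diff_0_right)
qed

text \<open>Exponential tilting moves the mean to \<open>a * \<sigma>\<^sup>2\<close>; the value of
  the integral is the normalizing constant left over.\<close>

lemma nn_integral_exp_gaussian:
  assumes "0 < \<sigma>"
  shows "(\<integral>\<^sup>+x. ennreal (exp (a * x)) \<partial>gaussian \<sigma>) = ennreal (exp (a\<^sup>2 * \<sigma>\<^sup>2 / 2))"
proof -
  have "normal_density 0 \<sigma> x * exp (a * x) = exp (a\<^sup>2 * \<sigma>\<^sup>2 / 2) * normal_density (a * \<sigma>\<^sup>2) \<sigma> x" for x
  proof -
    have "a * x = a\<^sup>2 * \<sigma>\<^sup>2 / 2 + (a * \<sigma>\<^sup>2 * x / \<sigma>\<^sup>2 - (a * \<sigma>\<^sup>2)\<^sup>2 / (2 * \<sigma>\<^sup>2))"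
      using assms by (simp add: power2_eq_square)
    then show ?thesis
      unfolding normal_density_shift[OF assms, of "a * \<sigma>\<^sup>2"] by (simp only: exp_add ac_simps)
  qed
  then show ?thesis
    using assms by (simp add: nn_integral_density ennreal_mult'[symmetric])
      (simp add: ennreal_mult' nn_integral_cmult nn_integral_normal_density)
qed

lemma nn_integral_exp_square_gaussian:
  assumes "r < 1"
  shows "(\<integral>\<^sup>+x. ennreal (exp (r * x\<^sup>2 / 2)) \<partial>gaussian 1) = ennreal (1 / sqrt (1 - r))"
proof -
  \<comment> \<open>The weight exp (r x^2 / 2) lowers the precision of the standard Gaussian from 1
    to 1 - r; this is the matching standard deviation.\<close>
  define \<sigma> where "\<sigma> = 1 / sqrt (1 - r)"
  have \<sigma>: "0 < \<sigma>" and \<sigma>2: "\<sigma>\<^sup>2 = 1 / (1 - r)"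
    using assms by (auto simp: \<sigma>_def power_divide)
  have "normal_density 0 1 x * exp (r * x\<^sup>2 / 2) = \<sigma> * normal_density 0 \<sigma> x" for x
  proof -
    have "- (x\<^sup>2 / 2) + r * x\<^sup>2 / 2 = - (x\<^sup>2 / (2 * \<sigma>\<^sup>2))"
      using assms by (simp add: \<sigma>2 field_simps)
    moreover have "sqrt (2 * pi * \<sigma>\<^sup>2) = sqrt (2 * pi) * \<sigma>"
      using \<sigma> by (simp add: real_sqrt_mult)
    ultimately show ?thesis
      using \<sigma> by (simp add: normal_density_def mult_exp_exp)
  qed
  then show ?thesis
    using \<sigma> by (simp add: nn_integral_density ennreal_mult'[symmetric] \<sigma>_def[symmetric])
      (simp add: ennreal_mult' nn_integral_cmult nn_integral_normal_density)
qed

section \<open>Finite products of Gaussians\<close>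

lemma product_prob_space_gaussian:
  assumes "\<And>i. 0 < \<sigma> i"
  shows "product_prob_space (\<lambda>i. gaussian (\<sigma> i))"
  using assms by (intro product_prob_spaceI prob_space_normal_density)

lemma nn_integral_exp_gaussians:
  assumes "finite I" and \<sigma>: "\<And>i. 0 < \<sigma> i"
  shows "(\<integral>\<^sup>+g. ennreal (exp (\<Sum>i\<in>I. a i * g i)) \<partial>PiM I (\<lambda>i. gaussian (\<sigma> i))) =
    ennreal (exp (\<Sum>i\<in>I. (a i)\<^sup>2 * (\<sigma> i)\<^sup>2 / 2))"
proof -
  interpret product_prob_space "\<lambda>i. gaussian (\<sigma> i)"
    using \<sigma> by (rule product_prob_space_gaussian)
  have "(\<integral>\<^sup>+g. ennreal (exp (\<Sum>i\<in>I. a i * g i)) \<partial>PiM I (\<lambda>i. gaussian (\<sigma> i))) =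
      (\<integral>\<^sup>+g. (\<Prod>i\<in>I. ennreal (exp (a i * g i))) \<partial>PiM I (\<lambda>i. gaussian (\<sigma> i)))"
    using \<open>finite I\<close> by (simp add: exp_sum prod_ennreal)
  also have "\<dots> = (\<Prod>i\<in>I. \<integral>\<^sup>+x. ennreal (exp (a i * x)) \<partial>gaussian (\<sigma> i))"
    using \<open>finite I\<close> by (intro product_nn_integral_prod) auto
  also have "\<dots> = ennreal (exp (\<Sum>i\<in>I. (a i)\<^sup>2 * (\<sigma> i)\<^sup>2 / 2))"
    using \<open>finite I\<close> \<sigma> by (simp add: nn_integral_exp_gaussian exp_sum prod_ennreal)
  finally show ?thesis .
qed

lemma nn_integral_exp_sum_squares_gaussians:
  assumes "finite I" and "r < 1"
  shows "(\<integral>\<^sup>+g. ennreal (exp (r / 2 * (\<Sum>i\<in>I. (g i)\<^sup>2))) \<partial>PiM I (\<lambda>i. gaussian 1)) =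
    ennreal ((1 / sqrt (1 - r)) ^ card I)"
proof -
  interpret product_prob_space "\<lambda>i. gaussian 1"
    by (rule product_prob_space_gaussian) simp
  have "(\<integral>\<^sup>+g. ennreal (exp (r / 2 * (\<Sum>i\<in>I. (g i)\<^sup>2))) \<partial>PiM I (\<lambda>i. gaussian 1)) =
      (\<integral>\<^sup>+g. (\<Prod>i\<in>I. ennreal (exp (r * (g i)\<^sup>2 / 2))) \<partial>PiM I (\<lambda>i. gaussian 1))"
    using \<open>finite I\<close> by (simp add: exp_sum prod_ennreal sum_distrib_left)
  also have "\<dots> = (\<Prod>i\<in>I. \<integral>\<^sup>+x. ennreal (exp (r * x\<^sup>2 / 2)) \<partial>gaussian 1)"
    using \<open>finite I\<close> by (intro product_nn_integral_prod) auto
  also have "\<dots> = ennreal ((1 / sqrt (1 - r)) ^ card I)"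
    using assms by (simp add: nn_integral_exp_square_gaussian ennreal_power)
  finally show ?thesis .
qed

lemma distr_shift_gaussian:
  assumes "0 < \<sigma>"
  shows "distr (gaussian \<sigma>) borel (\<lambda>x. x + h) =
    density (gaussian \<sigma>) (\<lambda>x. ennreal (exp (h * x / \<sigma>\<^sup>2 - h\<^sup>2 / (2 * \<sigma>\<^sup>2))))"
proof -
  interpret prob_space "gaussian \<sigma>"
    using assms by (rule prob_space_normal_density)
  have "distributed (gaussian \<sigma>) lborel (\<lambda>x. x) (normal_density 0 \<sigma>)"
    by (simp add: distributed_def distr_id2)
  then have "distributed (gaussian \<sigma>) lborel (\<lambda>x. h + x * 1) (normal_density (h + 0 * 1) (\<bar>1\<bar> * \<sigma>))"
    using assms normal_density_affine[of "\<lambda>x. x" 0 \<sigma> 1 h] by simp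
  then have "distr (gaussian \<sigma>) lborel (\<lambda>x. x + h) = density lborel (normal_density h \<sigma>)"
    by (simp add: distributed_def add.commute)
  moreover have "distr (gaussian \<sigma>) borel (\<lambda>x. x + h) = distr (gaussian \<sigma>) lborel (\<lambda>x. x + h)"
    by (intro distr_cong) auto
  ultimately show ?thesis
    using assms by (simp add: density_density_eq normal_density_shift[of \<sigma> h] ennreal_mult')
qed

text \<open>Cameron-Martin formula for independent Gaussians. The law of the shifted vector and the
  reweighted measure are both identified, on boxes, with the product of the shifted one-dimensional
  laws.\<close>

lemma nn_integral_shift_gaussians:
  assumes "finite I" and \<sigma>: "\<And>i. 0 < \<sigma> i"
    and F: "F \<in> borel_measurable (PiM I (\<lambda>i. gaussian (\<sigma> i)))"
  shows "(\<integral>\<^sup>+g. F (\<lambda>i\<in>I. g i + h i) \<partial>PiM I (\<lambda>i. gaussian (\<sigma> i))) =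
    (\<integral>\<^sup>+g. ennreal (exp (\<Sum>i\<in>I. h i * g i / (\<sigma> i)\<^sup>2 - (h i)\<^sup>2 / (2 * (\<sigma> i)\<^sup>2))) * F g
      \<partial>PiM I (\<lambda>i. gaussian (\<sigma> i)))"
proof -
  interpret product_prob_space "\<lambda>i. gaussian (\<sigma> i)"
    using \<sigma> by (rule product_prob_space_gaussian)
  let ?G = "PiM I (\<lambda>i. gaussian (\<sigma> i))"
  define w where "w i x = exp (h i * x / (\<sigma> i)\<^sup>2 - (h i)\<^sup>2 / (2 * (\<sigma> i)\<^sup>2))" for i x
  have [measurable]: "w i \<in> borel_measurable borel" for i
    unfolding w_def by measurable
  let ?S = "\<lambda>i. distr (gaussian (\<sigma> i)) borel (\<lambda>x. x + h i)"
  have prob: "prob_space (?S i)" for i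
    using \<sigma> by (intro prob_space.prob_space_distr prob_space_normal_density) auto
  interpret S: product_prob_space ?S
    using prob by (rule product_prob_spaceI)
  have "distr ?G (PiM I ?S) (\<lambda>g. \<lambda>i\<in>I. g i + h i) = PiM I ?S"
  proof (rule S.PiM_eqI)
    fix A assume "\<And>i. i \<in> I \<Longrightarrow> A i \<in> sets (?S i)"
    then have A: "\<And>i. i \<in> I \<Longrightarrow> A i \<in> sets borel"
      by simp
    have meas: "(\<lambda>g. \<lambda>i\<in>I. g i + h i) \<in> measurable ?G (PiM I ?S)"
      by measurable
    have "emeasure (distr ?G (PiM I ?S) (\<lambda>g. \<lambda>i\<in>I. g i + h i)) (Pi\<^sub>E I A) =
        emeasure ?G ((\<lambda>g. \<lambda>i\<in>I. g i + h i) -` Pi\<^sub>E I A \<inter> space ?G)"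
      using A \<open>finite I\<close> by (intro emeasure_distr meas sets_PiM_I_finite) auto
    also have "(\<lambda>g. \<lambda>i\<in>I. g i + h i) -` Pi\<^sub>E I A \<inter> space ?G =
        Pi\<^sub>E I (\<lambda>i. (\<lambda>x. x + h i) -` A i)"
      by (auto simp: space_PiM PiE_iff extensional_def)
    also have "emeasure ?G \<dots> = (\<Prod>i\<in>I. emeasure (gaussian (\<sigma> i)) ((\<lambda>x. x + h i) -` A i))"
      using A \<open>finite I\<close> by (intro emeasure_PiM) (auto intro!: measurable_sets_borel[of _ borel])
    also have "\<dots> = (\<Prod>i\<in>I. emeasure (?S i) (A i))"
      using A by (intro prod.cong refl) (simp add: emeasure_distr)
    finally show "emeasure (distr ?G (PiM I ?S) (\<lambda>g. \<lambda>i\<in>I. g i + h i)) (Pi\<^sub>E I A) =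
        (\<Prod>i\<in>I. emeasure (?S i) (A i))" .
  qed (use \<open>finite I\<close> in auto)
  moreover have "density ?G (\<lambda>g. ennreal (\<Prod>i\<in>I. w i (g i))) = PiM I ?S"
  proof (rule S.PiM_eqI)
    show "sets (density ?G (\<lambda>g. ennreal (\<Prod>i\<in>I. w i (g i)))) = sets (PiM I ?S)"
      by (auto intro!: sets_PiM_cong)
    fix A assume "\<And>i. i \<in> I \<Longrightarrow> A i \<in> sets (?S i)"
    then have A: "\<And>i. i \<in> I \<Longrightarrow> A i \<in> sets borel"
      by simp
    have "emeasure (density ?G (\<lambda>g. ennreal (\<Prod>i\<in>I. w i (g i)))) (Pi\<^sub>E I A) =
        (\<integral>\<^sup>+g. ennreal (\<Prod>i\<in>I. w i (g i)) * indicator (Pi\<^sub>E I A) g \<partial>?G)"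
      using A \<open>finite I\<close> by (intro emeasure_density sets_PiM_I_finite) auto
    also have "\<dots> = (\<integral>\<^sup>+g. (\<Prod>i\<in>I. ennreal (w i (g i)) * indicator (A i) (g i)) \<partial>?G)"
    proof (intro nn_integral_cong)
      fix g assume "g \<in> space ?G"
      then have "indicator (Pi\<^sub>E I A) g = (\<Prod>i\<in>I. indicator (A i) (g i) :: ennreal)"
        using \<open>finite I\<close> by (auto simp: indicator_def PiE_iff space_PiM prod_eq_1_iff intro!: prod_zero[symmetric] prod.neutral[symmetric])
      then show "ennreal (\<Prod>i\<in>I. w i (g i)) * indicator (Pi\<^sub>E I A) g =
          (\<Prod>i\<in>I. ennreal (w i (g i)) * indicator (A i) (g i))"
        by (simp add: prod.distrib prod_ennreal w_def)
    qed
    also have "\<dots> = (\<Prod>i\<in>I. \<integral>\<^sup>+x. ennreal (w i x) * indicator (A i) x \<partial>gaussian (\<sigma> i))"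
      using A \<open>finite I\<close> by (intro product_nn_integral_prod) auto
    also have "\<dots> = (\<Prod>i\<in>I. emeasure (?S i) (A i))"
      using A \<sigma> by (intro prod.cong refl)
        (simp add: distr_shift_gaussian emeasure_density w_def)
    finally show "emeasure (density ?G (\<lambda>g. ennreal (\<Prod>i\<in>I. w i (g i)))) (Pi\<^sub>E I A) =
        (\<Prod>i\<in>I. emeasure (?S i) (A i))" .
  qed (use \<open>finite I\<close> in auto)
  ultimately have eq: "distr ?G (PiM I ?S) (\<lambda>g. \<lambda>i\<in>I. g i + h i) =
      density ?G (\<lambda>g. ennreal (\<Prod>i\<in>I. w i (g i)))"
    by simp
  have sets: "sets (PiM I ?S) = sets ?G"
    by (intro sets_PiM_cong) auto
  have "(\<integral>\<^sup>+g. F (\<lambda>i\<in>I. g i + h i) \<partial>?G) = (\<integral>\<^sup>+g. F g \<partial>distr ?G (PiM I ?S) (\<lambda>g. \<lambda>i\<in>I. g i + h i))"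
    using F by (subst nn_integral_distr) (auto simp: measurable_cong_sets[OF sets refl])
  also have "\<dots> = (\<integral>\<^sup>+g. ennreal (\<Prod>i\<in>I. w i (g i)) * F g \<partial>?G)"
    unfolding eq using F by (intro nn_integral_density) auto
  finally show ?thesis
    using \<open>finite I\<close> by (simp add: w_def exp_sum)
qed

section \<open>The exponential moments of an orthogonal matrix\<close>

text \<open>Hoeffding's lemma for a fair sign: at h = 2 x and p = 1/2 the function it bounds is ln
  (cosh x). Evenness covers negative \<open>x\<close>.\<close>

lemma cosh_le_exp_square:
  fixes x :: real
  shows "cosh x \<le> exp (x\<^sup>2 / 2)"
proof -
  have "cosh x \<le> exp (x\<^sup>2 / 2)" if "0 \<le> x" for x :: real
  proof -
    have "- x + ln (1 + 1 / 2 * (exp (2 * x) - 1)) \<le> x\<^sup>2 / 2"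
      using Hoeffdings_lemma_aux[of "2 * x" "1 / 2"] that by (simp add: power2_eq_square)
    then have "exp (- x + ln (1 + 1 / 2 * (exp (2 * x) - 1))) \<le> exp (x\<^sup>2 / 2)"
      by simp
    moreover have "exp (- x + ln (1 + 1 / 2 * (exp (2 * x) - 1))) = exp (- x) * ((1 + exp (2 * x)) / 2)"
      by (subst exp_add) (simp add: field_simps add_pos_pos)
    moreover have "\<dots> = cosh x"
      by (simp add: cosh_def algebra_simps add_divide_distrib flip: exp_add)
    ultimately show ?thesis
      by linarith
  qed
  from this[of x] this[of "- x"] show ?thesis
    by (cases "0 \<le> x") auto
qed

text \<open>The definition of \<open>orthogonal_group\<close> speaks of columns only. This is
  Bessel's inequality for the orthonormal columns: subtracting from \<open>v\<close> its projection,
  with coefficients \<open>t c\<close>, leaves a residual of nonnegative squared norm. All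
  information on rows is drawn from it.\<close>

lemma orthogonal_group_Bessel:
  assumes A: "A \<in> orthogonal_group d"
  shows "(\<Sum>c<d. (\<Sum>b<d. v b * A (b, c))\<^sup>2) \<le> (\<Sum>b<d. (v b)\<^sup>2)"
proof -
  define t where "t c = (\<Sum>b<d. v b * A (b, c))" for c
  have orth: "(\<Sum>b<d. A (b, c) * A (b, c')) = (if c = c' then 1 else 0)" if "c < d" "c' < d" for c c'
    using A that by (auto simp: orthogonal_group_def)
  have cross: "(\<Sum>b<d. v b * (\<Sum>c<d. t c * A (b, c))) = (\<Sum>c<d. (t c)\<^sup>2)"
  proof -
    have "(\<Sum>b<d. v b * (\<Sum>c<d. t c * A (b, c))) = (\<Sum>c<d. \<Sum>b<d. t c * (v b * A (b, c)))"
      by (subst sum.swap) (simp add: sum_distrib_left ac_simps)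
    then show ?thesis
      by (simp add: t_def power2_eq_square flip: sum_distrib_left)
  qed
  have square: "(\<Sum>b<d. (\<Sum>c<d. t c * A (b, c))\<^sup>2) = (\<Sum>c<d. (t c)\<^sup>2)"
  proof -
    have "(\<Sum>b<d. (\<Sum>c<d. t c * A (b, c))\<^sup>2) =
        (\<Sum>b<d. \<Sum>c<d. \<Sum>c'<d. t c * t c' * (A (b, c) * A (b, c')))"
      by (simp add: power2_eq_square sum_product ac_simps)
    also have "\<dots> = (\<Sum>c<d. \<Sum>c'<d. t c * t c' * (\<Sum>b<d. A (b, c) * A (b, c')))"
      unfolding sum_distrib_left by (rule trans[OF sum.swap]) (intro sum.cong refl sum.swap)
    also have "\<dots> = (\<Sum>c<d. \<Sum>c'<d. t c * t c' * (if c = c' then 1 else 0))"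
      by (intro sum.cong refl) (simp add: orth)
    also have "\<dots> = (\<Sum>c<d. (t c)\<^sup>2)"
      by (intro sum.cong refl) (simp add: power2_eq_square if_distrib cong: if_cong)
    finally show ?thesis .
  qed
  have "0 \<le> (\<Sum>b<d. (v b - (\<Sum>c<d. t c * A (b, c)))\<^sup>2)"
    by (intro sum_nonneg) simp
  also have "\<dots> = (\<Sum>b<d. (v b)\<^sup>2) + (\<Sum>b<d. (\<Sum>c<d. t c * A (b, c))\<^sup>2)
      - 2 * (\<Sum>b<d. v b * (\<Sum>c<d. t c * A (b, c)))"
    by (simp add: power2_diff sum.distrib sum_subtractf sum_distrib_left ac_simps)
  finally show ?thesis
    using cross square by (simp add: t_def)
qed

text \<open>Bessel's inequality for a standard basis vector, whose coefficients along the columns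
  form row \<open>a\<close>.\<close>

lemma orthogonal_group_row_norm:
  assumes "A \<in> orthogonal_group d" "a < d"
  shows "(\<Sum>c<d. (A (a, c))\<^sup>2) \<le> 1"
proof -
  have "(\<Sum>b<d. (if b = a then 1 else 0) * A (b, c)) = (\<Sum>b<d. if b = a then A (a, c) else 0)" for c
    by (intro sum.cong) auto
  moreover have "(\<Sum>b<d. (if b = a then 1 else 0 :: real)\<^sup>2) = (\<Sum>b<d. if b = a then 1 else 0)"
    by (intro sum.cong) auto
  ultimately show ?thesis
    using orthogonal_group_Bessel[OF assms(1), of "\<lambda>b. if b = a then 1 else 0"] \<open>a < d\<close> by simp
qed

text \<open>Unnormalized expectation over independent fair signs: each sign contributes a factor 2
  cosh.\<close>

lemma sum_signs_exp:
  fixes y :: "'a \<Rightarrow> real"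
  assumes "finite I"
  shows "(\<Sum>e\<in>PiE I (\<lambda>_. {-1, 1}). exp (\<Sum>a\<in>I. e a * y a)) = 2 ^ card I * (\<Prod>a\<in>I. cosh (y a))"
proof -
  have "(\<Sum>e\<in>PiE I (\<lambda>_. {-1, 1}). exp (\<Sum>a\<in>I. e a * y a)) =
      (\<Sum>e\<in>PiE I (\<lambda>_. {-1, 1}). \<Prod>a\<in>I. exp (e a * y a))"
    using assms by (simp add: exp_sum)
  also have "\<dots> = (\<Prod>a\<in>I. \<Sum>s\<in>{-1, 1}. exp (s * y a))"
    using assms by (intro prod_sum_PiE[symmetric]) auto
  also have "\<dots> = (\<Prod>a\<in>I. 2 * cosh (y a))"
    by (intro prod.cong refl) (simp add: cosh_def)
  finally show ?thesis
    by (simp add: prod.distrib)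
qed

section \<open>Haar measure on the orthogonal group\<close>

lemma haar_orthogonal_sets:
  assumes "haar_orthogonal d \<mu>"
  shows "sets \<mu> = sets (PiM ({..<d} \<times> {..<d}) (\<lambda>_. borel :: real measure))"
  using assms by (simp add: haar_orthogonal_def)

lemma measurable_haar_entry:
  assumes "haar_orthogonal d \<mu>" "a < d" "c < d"
  shows "(\<lambda>A. A (a, c)) \<in> borel_measurable \<mu>"
  using assms by (subst measurable_cong_sets[OF haar_orthogonal_sets refl]) auto

text \<open>Haar measure is invariant under sign changes of the rows, so the row sums
  \<open>\<Sum>\<^sub>c B a c * O (a, c)\<close>, which are at most the norm of row \<open>a\<close> of \<open>B\<close>, carry independent
  random signs.\<close>

lemma haar_exp_moment:
  assumes haar: "haar_orthogonal d \<mu>"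
  shows "(\<integral>\<^sup>+A. ennreal (exp (\<Sum>a<d. \<Sum>c<d. B a c * A (a, c))) \<partial>\<mu>)
    \<le> ennreal (exp ((\<Sum>a<d. \<Sum>c<d. (B a c)\<^sup>2) / 2))"
proof -
  interpret prob_space \<mu>
    using haar by (simp add: haar_orthogonal_def)
  note [measurable] = measurable_haar_entry[OF haar]
  define y where "y A a = (\<Sum>c<d. B a c * A (a, c))" for A :: matrix and a
  have [measurable]: "(\<lambda>A. y A a) \<in> borel_measurable \<mu>" if "a < d" for a
    unfolding y_def using that by measurable
  let ?E = "PiE {..<d} (\<lambda>_. {-1, 1 :: real})"
  \<comment> \<open>Diagonal sign matrices: left multiplication by \<open>D e\<close> multiplies row
    \<open>a\<close> by \<open>e a\<close>.\<close>
  define D where "D e = (\<lambda>(a, b)\<in>{..<d} \<times> {..<d}. if a = b then e a else 0)" for e :: "nat \<Rightarrow> real"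
  have D: "D e \<in> orthogonal_group d" if "e \<in> ?E" for e
  proof -
    have "e a * e a = 1" if "a < d" for a
    proof -
      have "e a \<in> {-1, 1}"
        using PiE_mem[OF \<open>e \<in> ?E\<close>, of a] \<open>a < d\<close> by simp
      then show ?thesis
        by auto
    qed
    moreover have "(\<Sum>c<d. D e (c, a) * D e (c, b)) = (\<Sum>c<d. if c = a then if a = b then e a * e a else 0 else 0)"
      if "a < d" "b < d" for a b
      using that by (intro sum.cong refl) (auto simp: D_def)
    ultimately show ?thesis
      by (auto simp: orthogonal_group_def D_def)
  qed
  have mult_D: "y (mat_mult d (D e) A) a = e a * y A a" if "a < d" for e A a
  proof -
    have "mat_mult d (D e) A (a, c) = e a * A (a, c)" if "c < d" for c
    proof -
      have "mat_mult d (D e) A (a, c) = (\<Sum>b<d. D e (a, b) * A (b, c))"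
        using \<open>a < d\<close> that by (simp add: mat_mult_def)
      also have "\<dots> = (\<Sum>b<d. if b = a then e a * A (a, c) else 0)"
        using \<open>a < d\<close> by (intro sum.cong refl) (auto simp: D_def)
      finally show ?thesis
        using \<open>a < d\<close> by simp
    qed
    then show ?thesis
      by (simp add: y_def sum_distrib_left ac_simps)
  qed
  have flip: "(\<integral>\<^sup>+A. ennreal (exp (\<Sum>a<d. y A a)) \<partial>\<mu>) =
      (\<integral>\<^sup>+A. ennreal (exp (\<Sum>a<d. e a * y A a)) \<partial>\<mu>)" if e: "e \<in> ?E" for e
  proof -
    have meas: "mat_mult d (D e) \<in> measurable \<mu> \<mu>"
      unfolding mat_mult_def
      by (subst measurable_cong_sets[OF refl haar_orthogonal_sets[OF haar]]) (auto intro!: measurable_restrict)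
    have "distr \<mu> \<mu> (mat_mult d (D e)) = \<mu>"
      using haar D[OF e] by (simp add: haar_orthogonal_def)
    then have "(\<integral>\<^sup>+A. ennreal (exp (\<Sum>a<d. y A a)) \<partial>\<mu>) =
        (\<integral>\<^sup>+A. ennreal (exp (\<Sum>a<d. y A a)) \<partial>distr \<mu> \<mu> (mat_mult d (D e)))"
      by simp
    also have "\<dots> = (\<integral>\<^sup>+A. ennreal (exp (\<Sum>a<d. y (mat_mult d (D e) A) a)) \<partial>\<mu>)"
      by (intro nn_integral_distr meas) measurable
    finally show ?thesis
      by (simp add: mult_D)
  qed
  have bound: "(\<Prod>a<d. cosh (y A a)) \<le> exp ((\<Sum>a<d. \<Sum>c<d. (B a c)\<^sup>2) / 2)"
    if A: "A \<in> orthogonal_group d" for A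
  proof -
    have "cosh (y A a) \<le> exp ((\<Sum>c<d. (B a c)\<^sup>2) / 2)" if "a < d" for a
    proof -
      have "(y A a)\<^sup>2 \<le> (\<Sum>c<d. (B a c)\<^sup>2) * (\<Sum>c<d. (A (a, c))\<^sup>2)"
        unfolding y_def by (rule Cauchy_Schwarz_ineq_sum)
      also have "\<dots> \<le> (\<Sum>c<d. (B a c)\<^sup>2) * 1"
        using orthogonal_group_row_norm[OF A that] by (intro mult_left_mono sum_nonneg) auto
      finally show ?thesis
        using cosh_le_exp_square[of "y A a"] by (smt (verit) exp_le_cancel_iff divide_right_mono)
    qed
    then have "(\<Prod>a<d. cosh (y A a)) \<le> (\<Prod>a<d. exp ((\<Sum>c<d. (B a c)\<^sup>2) / 2))"
      by (intro prod_mono) auto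
    then show ?thesis
      by (simp add: exp_sum sum_divide_distrib)
  qed
  have card: "card ?E = 2 ^ d"
    by (simp add: card_PiE numeral_2_eq_2)
  have fin: "finite ?E"
    by (intro finite_PiE) auto
  \<comment> \<open>By invariance all 2^d sign patterns give the same integral, so their sum may be
    taken inside, where it becomes a product of hyperbolic cosines.\<close>
  have "2 ^ d * (\<integral>\<^sup>+A. ennreal (exp (\<Sum>a<d. y A a)) \<partial>\<mu>) =
      (\<Sum>e\<in>?E. \<integral>\<^sup>+A. ennreal (exp (\<Sum>a<d. y A a)) \<partial>\<mu>)"
    by (simp add: card)
  also have "\<dots> = (\<Sum>e\<in>?E. \<integral>\<^sup>+A. ennreal (exp (\<Sum>a<d. e a * y A a)) \<partial>\<mu>)"
    by (intro sum.cong refl flip)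
  also have "\<dots> = (\<integral>\<^sup>+A. ennreal (\<Sum>e\<in>?E. exp (\<Sum>a<d. e a * y A a)) \<partial>\<mu>)"
    using fin by (subst nn_integral_sum[symmetric]) auto
  also have "\<dots> = (\<integral>\<^sup>+A. ennreal (2 ^ d * (\<Prod>a<d. cosh (y A a))) \<partial>\<mu>)"
    by (simp add: sum_signs_exp)
  also have "\<dots> \<le> (\<integral>\<^sup>+A. ennreal (2 ^ d * exp ((\<Sum>a<d. \<Sum>c<d. (B a c)\<^sup>2) / 2)) \<partial>\<mu>)"
  proof (rule nn_integral_mono_AE)
    have "AE A in \<mu>. A \<in> orthogonal_group d"
      using haar by (simp add: haar_orthogonal_def)
    then show "AE A in \<mu>. ennreal (2 ^ d * (\<Prod>a<d. cosh (y A a)))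
        \<le> ennreal (2 ^ d * exp ((\<Sum>a<d. \<Sum>c<d. (B a c)\<^sup>2) / 2))"
      by eventually_elim (intro ennreal_leI mult_left_mono bound; simp)
  qed
  also have "\<dots> = 2 ^ d * ennreal (exp ((\<Sum>a<d. \<Sum>c<d. (B a c)\<^sup>2) / 2))"
    by (simp add: emeasure_space_1 ennreal_mult ennreal_power[symmetric])
  finally show ?thesis
    by (subst (asm) ennreal_mult_le_mult_iff) (auto simp: y_def power_eq_top_ennreal)
qed

lemma measurable_block_entry:
  fixes n :: nat
  assumes haar: "haar_orthogonal d \<mu>" and "i < n" "a < d" "c < d"
  shows "(\<lambda>V. V i (a, c)) \<in> borel_measurable (PiM {..<n} (\<lambda>_. \<mu>))"
  using assms by (intro measurable_compose[OF _ measurable_haar_entry[OF haar]] measurable_component_singleton) auto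

lemma AE_blocks_orthogonal:
  fixes n :: nat
  assumes haar: "haar_orthogonal d \<mu>"
  shows "AE V in PiM {..<n} (\<lambda>_. \<mu>). \<forall>i<n. V i \<in> orthogonal_group d"
proof -
  have "AE V in PiM {..<n} (\<lambda>_. \<mu>). V i \<in> orthogonal_group d" if "i \<in> {..<n}" for i
    using haar that by (intro AE_PiM_component) (auto simp: haar_orthogonal_def)
  then have "AE V in PiM {..<n} (\<lambda>_. \<mu>). \<forall>i\<in>{..<n}. V i \<in> orthogonal_group d"
    by (intro AE_finite_allI finite_lessThan)
  then show ?thesis
    by eventually_elim auto
qed

text \<open>The square is linearized by an auxiliary Gaussian \<open>d \<times> d\<close> matrix \<open>G\<close>
  (Hubbard--Stratonovich), after which the blocks of \<open>V\<close> decouple.\<close>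

lemma haar_overlap_exp_moment:
  assumes haar: "haar_orthogonal d \<mu>" and \<kappa>: "0 \<le> \<kappa>" "2 * \<kappa> * real n < 1"
    and W: "\<forall>i<n. W i \<in> orthogonal_group d"
  shows "(\<integral>\<^sup>+V. ennreal (exp (\<kappa> * (\<Sum>a<d. \<Sum>b<d. (\<Sum>i<n. \<Sum>c<d. V i (a, c) * W i (b, c))\<^sup>2)))
      \<partial>PiM {..<n} (\<lambda>_. \<mu>)) \<le> ennreal ((1 / sqrt (1 - 2 * \<kappa> * real n)) ^ d\<^sup>2)"
proof -
  have pr: "prob_space \<mu>"
    using haar by (simp add: haar_orthogonal_def)
  interpret P: product_prob_space "\<lambda>_::nat. \<mu>"
    using pr by (rule product_prob_spaceI)
  let ?I = "{..<d} \<times> {..<d}"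
  let ?G = "PiM ?I (\<lambda>_. gaussian 1)"
  let ?V = "PiM {..<n} (\<lambda>_. \<mu>)"
  interpret V: prob_space ?V
    using pr by (rule prob_space_PiM)
  interpret G: prob_space ?G
    by (rule prob_space_PiM) (simp add: prob_space_normal_density)
  interpret pair_sigma_finite ?V ?G ..
  note [measurable] = measurable_block_entry[OF haar] measurable_haar_entry[OF haar]
  define S where "S V a b = (\<Sum>i<n. \<Sum>c<d. V i (a, c) * W i (b, c))" for V :: "nat \<Rightarrow> matrix" and a b
  have [measurable]: "(\<lambda>V. S V a b) \<in> borel_measurable ?V" if "a < d" for a b
    unfolding S_def using that by measurable
  \<comment> \<open>For fixed \<open>g\<close> the exponent is linear in \<open>V\<close>, and
    \<open>B g i\<close> is the coefficient matrix of block \<open>i\<close>. The scale sqrt (2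
    \<kappa>) makes the Gaussian moment generating function return \<kappa> times the
    square.\<close>
  define B where "B g i a c = sqrt (2 * \<kappa>) * (\<Sum>b<d. g (a, b) * W i (b, c))" for g :: matrix and i a c
  have lin: "(\<Sum>p\<in>?I. sqrt (2 * \<kappa>) * S V (fst p) (snd p) * g p) =
      (\<Sum>i<n. \<Sum>a<d. \<Sum>c<d. B g i a c * V i (a, c))" for V g
  proof -
    have "(\<Sum>p\<in>?I. sqrt (2 * \<kappa>) * S V (fst p) (snd p) * g p) =
        (\<Sum>a<d. \<Sum>b<d. sqrt (2 * \<kappa>) * S V a b * g (a, b))"
      by (simp add: sum.cartesian_product case_prod_beta)
    also have "\<dots> = (\<Sum>a<d. \<Sum>b<d. \<Sum>i<n. \<Sum>c<d. sqrt (2 * \<kappa>) * g (a, b) * W i (b, c) * V i (a, c))"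
      by (simp add: S_def sum_distrib_left sum_distrib_right ac_simps)
    also have "\<dots> = (\<Sum>i<n. \<Sum>a<d. \<Sum>c<d. \<Sum>b<d. sqrt (2 * \<kappa>) * g (a, b) * W i (b, c) * V i (a, c))"
      by (subst (2) sum.swap, subst sum.swap, subst (3) sum.swap) simp
    finally show ?thesis
      by (simp add: B_def sum_distrib_left sum_distrib_right ac_simps)
  qed
  \<comment> \<open>Each row of \<open>g\<close> is multiplied by the orthogonal matrix
    \<open>W i\<close>, which does not increase its norm. The bound no longer depends on
    \<open>W\<close> or \<open>i\<close>.\<close>
  have B_sq: "(\<Sum>a<d. \<Sum>c<d. (B g i a c)\<^sup>2) / 2 \<le> \<kappa> * (\<Sum>p\<in>?I. (g p)\<^sup>2)" if "i < n" for g i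
  proof -
    have "(\<Sum>a<d. \<Sum>c<d. (B g i a c)\<^sup>2) = 2 * \<kappa> * (\<Sum>a<d. \<Sum>c<d. (\<Sum>b<d. g (a, b) * W i (b, c))\<^sup>2)"
      using \<kappa> by (simp add: B_def power_mult_distrib flip: sum_distrib_left)
    also have "\<dots> \<le> 2 * \<kappa> * (\<Sum>a<d. \<Sum>b<d. (g (a, b))\<^sup>2)"
      using W that \<kappa> by (intro mult_left_mono sum_mono orthogonal_group_Bessel) auto
    finally show ?thesis
      by (simp add: sum.cartesian_product case_prod_beta)
  qed
  have "(\<integral>\<^sup>+V. ennreal (exp (\<kappa> * (\<Sum>a<d. \<Sum>b<d. (S V a b)\<^sup>2))) \<partial>?V) =
      (\<integral>\<^sup>+V. \<integral>\<^sup>+g. ennreal (exp (\<Sum>p\<in>?I. sqrt (2 * \<kappa>) * S V (fst p) (snd p) * g p)) \<partial>?G \<partial>?V)"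
  proof (intro nn_integral_cong)
    fix V
    have "(\<Sum>p\<in>?I. (sqrt (2 * \<kappa>) * S V (fst p) (snd p))\<^sup>2 * 1\<^sup>2 / 2) =
        \<kappa> * (\<Sum>a<d. \<Sum>b<d. (S V a b)\<^sup>2)"
      using \<kappa> by (simp add: power_mult_distrib sum_distrib_left sum.cartesian_product case_prod_beta)
    then show "ennreal (exp (\<kappa> * (\<Sum>a<d. \<Sum>b<d. (S V a b)\<^sup>2))) =
        (\<integral>\<^sup>+g. ennreal (exp (\<Sum>p\<in>?I. sqrt (2 * \<kappa>) * S V (fst p) (snd p) * g p)) \<partial>?G)"
      using nn_integral_exp_gaussians[of ?I "\<lambda>_. 1" "\<lambda>p. sqrt (2 * \<kappa>) * S V (fst p) (snd p)"] by simp
  qed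
  also have "\<dots> = (\<integral>\<^sup>+g. \<integral>\<^sup>+V. ennreal (exp (\<Sum>p\<in>?I. sqrt (2 * \<kappa>) * S V (fst p) (snd p) * g p)) \<partial>?V \<partial>?G)"
  proof (rule Fubini'[symmetric])
    have "(\<lambda>x. S (fst x) (fst p) (snd p)) \<in> borel_measurable (?V \<Otimes>\<^sub>M ?G)" if "p \<in> ?I" for p
      using that by (intro measurable_compose[OF measurable_fst]) auto
    moreover have "(\<lambda>x. snd x p) \<in> borel_measurable (?V \<Otimes>\<^sub>M ?G)" if "p \<in> ?I" for p
      using measurable_component_singleton[OF that, of "\<lambda>_. gaussian 1"]
      by (intro measurable_compose[OF measurable_snd]) simp
    ultimately show "(\<lambda>(V, g). ennreal (exp (\<Sum>p\<in>?I. sqrt (2 * \<kappa>) * S V (fst p) (snd p) * g p)))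
        \<in> borel_measurable (?V \<Otimes>\<^sub>M ?G)"
      unfolding case_prod_beta
      by (intro measurable_compose[OF _ measurable_ennreal] borel_measurable_sum
          measurable_compose[OF _ borel_measurable_exp]
          borel_measurable_times borel_measurable_const)
  qed
  \<comment> \<open>Each of the \<open>n\<close> independent blocks contributes at most \<kappa>
    times the squared norm of \<open>g\<close>. The condition 2 \<kappa> n < 1 keeps the remaining
    Gaussian integral finite.\<close>
  also have "\<dots> \<le> (\<integral>\<^sup>+g. ennreal (exp (2 * \<kappa> * real n / 2 * (\<Sum>p\<in>?I. (g p)\<^sup>2))) \<partial>?G)"
  proof (intro nn_integral_mono)
    fix g
    have "(\<integral>\<^sup>+V. ennreal (exp (\<Sum>p\<in>?I. sqrt (2 * \<kappa>) * S V (fst p) (snd p) * g p)) \<partial>?V) =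
        (\<integral>\<^sup>+V. (\<Prod>i<n. ennreal (exp (\<Sum>a<d. \<Sum>c<d. B g i a c * V i (a, c)))) \<partial>?V)"
      unfolding lin exp_sum[OF finite_lessThan[of n]] by (simp add: prod_ennreal)
    also have "\<dots> = (\<Prod>i<n. \<integral>\<^sup>+A. ennreal (exp (\<Sum>a<d. \<Sum>c<d. B g i a c * A (a, c))) \<partial>\<mu>)"
      by (rule P.product_nn_integral_prod) auto
    also have "\<dots> \<le> (\<Prod>i<n. ennreal (exp (\<kappa> * (\<Sum>p\<in>?I. (g p)\<^sup>2))))"
      using B_sq by (intro prod_mono_ennreal order.trans[OF haar_exp_moment[OF haar]] ennreal_leI)
        (simp del: sum_divide_distrib divide_le_eq_numeral1)
    also have "\<dots> = ennreal (exp (2 * \<kappa> * real n / 2 * (\<Sum>p\<in>?I. (g p)\<^sup>2)))"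
      by (simp add: ennreal_power exp_of_nat_mult[symmetric] ac_simps)
    finally show "(\<integral>\<^sup>+V. ennreal (exp (\<Sum>p\<in>?I. sqrt (2 * \<kappa>) * S V (fst p) (snd p) * g p)) \<partial>?V)
        \<le> ennreal (exp (2 * \<kappa> * real n / 2 * (\<Sum>p\<in>?I. (g p)\<^sup>2)))" .
  qed
  also have "\<dots> = ennreal ((1 / sqrt (1 - 2 * \<kappa> * real n)) ^ card ?I)"
    using \<kappa> by (intro nn_integral_exp_sum_squares_gaussians) auto
  finally show ?thesis
    by (simp add: S_def power2_eq_square)
qed

section \<open>Recovery from Gaussian noise\<close>

text \<open>Correlation, under centered noise, of the likelihood ratios for the shifts
  \<open>h\<close> and \<open>k\<close>: their normalizations cancel the squares and only the cross
  term survives.\<close>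

lemma nn_integral_exp_gaussian_pair:
  assumes "finite I" and \<sigma>: "\<And>i. 0 < \<sigma> i"
  shows "(\<integral>\<^sup>+g. ennreal (exp (\<Sum>i\<in>I. h i * g i / (\<sigma> i)\<^sup>2 - (h i)\<^sup>2 / (2 * (\<sigma> i)\<^sup>2))) *
        ennreal (exp (\<Sum>i\<in>I. k i * g i / (\<sigma> i)\<^sup>2 - (k i)\<^sup>2 / (2 * (\<sigma> i)\<^sup>2)))
      \<partial>PiM I (\<lambda>i. gaussian (\<sigma> i))) = ennreal (exp (\<Sum>i\<in>I. h i * k i / (\<sigma> i)\<^sup>2))"
proof -
  interpret product_prob_space "\<lambda>i. gaussian (\<sigma> i)"
    using \<sigma> by (rule product_prob_space_gaussian)
  let ?c = "\<Sum>i\<in>I. ((h i)\<^sup>2 + (k i)\<^sup>2) / (2 * (\<sigma> i)\<^sup>2)"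
  have "ennreal (exp (\<Sum>i\<in>I. h i * g i / (\<sigma> i)\<^sup>2 - (h i)\<^sup>2 / (2 * (\<sigma> i)\<^sup>2))) *
        ennreal (exp (\<Sum>i\<in>I. k i * g i / (\<sigma> i)\<^sup>2 - (k i)\<^sup>2 / (2 * (\<sigma> i)\<^sup>2))) =
      ennreal (exp (- ?c)) * ennreal (exp (\<Sum>i\<in>I. (h i + k i) / (\<sigma> i)\<^sup>2 * g i))" for g
  proof -
    have "(\<Sum>i\<in>I. h i * g i / (\<sigma> i)\<^sup>2 - (h i)\<^sup>2 / (2 * (\<sigma> i)\<^sup>2)) +
        (\<Sum>i\<in>I. k i * g i / (\<sigma> i)\<^sup>2 - (k i)\<^sup>2 / (2 * (\<sigma> i)\<^sup>2)) =
        - ?c + (\<Sum>i\<in>I. (h i + k i) / (\<sigma> i)\<^sup>2 * g i)"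
      unfolding sum.distrib[symmetric] sum_negf[symmetric]
      by (intro sum.cong refl) (simp add: add_divide_distrib algebra_simps)
    then show ?thesis
      by (simp add: ennreal_mult[symmetric] exp_add[symmetric])
  qed
  then have "(\<integral>\<^sup>+g. ennreal (exp (\<Sum>i\<in>I. h i * g i / (\<sigma> i)\<^sup>2 - (h i)\<^sup>2 / (2 * (\<sigma> i)\<^sup>2))) *
        ennreal (exp (\<Sum>i\<in>I. k i * g i / (\<sigma> i)\<^sup>2 - (k i)\<^sup>2 / (2 * (\<sigma> i)\<^sup>2)))
      \<partial>PiM I (\<lambda>i. gaussian (\<sigma> i))) =
      ennreal (exp (- ?c)) * (\<integral>\<^sup>+g. ennreal (exp (\<Sum>i\<in>I. (h i + k i) / (\<sigma> i)\<^sup>2 * g i))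
        \<partial>PiM I (\<lambda>i. gaussian (\<sigma> i)))"
    by (simp add: nn_integral_cmult)
  also have "\<dots> = ennreal (exp (- ?c + (\<Sum>i\<in>I. ((h i + k i) / (\<sigma> i)\<^sup>2)\<^sup>2 * (\<sigma> i)\<^sup>2 / 2)))"
    by (subst nn_integral_exp_gaussians) (auto simp: assms ennreal_mult[symmetric] exp_add[symmetric])
  also have "- ?c + (\<Sum>i\<in>I. ((h i + k i) / (\<sigma> i)\<^sup>2)\<^sup>2 * (\<sigma> i)\<^sup>2 / 2) = (\<Sum>i\<in>I. h i * k i / (\<sigma> i)\<^sup>2)"
    unfolding sum.distrib[symmetric] sum_negf[symmetric]
  proof (intro sum.cong refl)
    fix i
    show "- (((h i)\<^sup>2 + (k i)\<^sup>2) / (2 * (\<sigma> i)\<^sup>2)) + ((h i + k i) / (\<sigma> i)\<^sup>2)\<^sup>2 * (\<sigma> i)\<^sup>2 / 2 =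
        h i * k i / (\<sigma> i)\<^sup>2"
      using \<sigma>[of i] by (simp add: power2_eq_square field_simps)
  qed
  finally show ?thesis .
qed

text \<open>The signal \<open>(h, X)\<close> is observed twice: through \<open>h\<close> in the noise \<open>g\<close> seen by the estimator
  \<open>u\<close>, and through \<open>s X\<close> in a fresh standard Gaussian vector \<open>z\<close>. Integrating out \<open>z\<close> turns the
  overlap of \<open>u\<close> with \<open>X\<close> into a statistic \<open>exp (t \<langle>u, z\<rangle>)\<close> of the pair \<open>(g, z)\<close> whose second
  moment in the absence of a signal is at most \<open>exp (2 t\<^sup>2)\<close>. By Cauchy--Schwarz its expectation
  is controlled by the second moment of the likelihood ratio of the pair.\<close>

lemma recovery_exp_moment:
  fixes X :: "'v \<Rightarrow> 'k \<Rightarrow> real" and h :: "'v \<Rightarrow> 'i \<Rightarrow> real"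
  assumes fin: "finite I" "finite J" and \<sigma>: "\<And>i. 0 < \<sigma> i"
    and prob: "prob_space \<mu>" "prob_space \<tau>"
    and h[measurable]: "\<And>i. i \<in> I \<Longrightarrow> (\<lambda>v. h v i) \<in> borel_measurable \<mu>"
    and X[measurable]: "\<And>k. k \<in> J \<Longrightarrow> (\<lambda>v. X v k) \<in> borel_measurable \<mu>"
    and u[measurable]: "\<And>k. k \<in> J \<Longrightarrow>
      (\<lambda>(g, w). u g w k) \<in> borel_measurable (PiM I (\<lambda>i. gaussian (\<sigma> i)) \<Otimes>\<^sub>M \<tau>)"
    and u_norm: "\<And>g w. (\<Sum>k\<in>J. (u g w k)\<^sup>2) \<le> 1"
    and overlap: "(\<integral>\<^sup>+v'. \<integral>\<^sup>+v. ennreal (exp ((\<Sum>i\<in>I. h v i * h v' i / (\<sigma> i)\<^sup>2) +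
        s\<^sup>2 * (\<Sum>k\<in>J. X v k * X v' k))) \<partial>\<mu> \<partial>\<mu>) \<le> K"
  shows "(\<integral>\<^sup>+w. \<integral>\<^sup>+v. \<integral>\<^sup>+g. ennreal (exp (t * s * (\<Sum>k\<in>J. u (\<lambda>i\<in>I. g i + h v i) w k * X v k)))
      \<partial>PiM I (\<lambda>i. gaussian (\<sigma> i)) \<partial>\<mu> \<partial>\<tau>)\<^sup>2 \<le> ennreal (exp (2 * t\<^sup>2)) * K"
proof -
  let ?G = "PiM I (\<lambda>i. gaussian (\<sigma> i))"
  let ?Z = "PiM J (\<lambda>_::'k. gaussian 1)"
  interpret \<mu>: prob_space \<mu> by fact
  interpret \<tau>: prob_space \<tau> by fact
  interpret G: prob_space ?G
    using \<sigma> by (intro prob_space_PiM prob_space_normal_density)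
  interpret Z: prob_space ?Z
    by (intro prob_space_PiM prob_space_normal_density) simp
  interpret GZ: pair_prob_space ?G ?Z ..
  interpret \<mu>GZ: pair_prob_space \<mu> "?G \<Otimes>\<^sub>M ?Z" ..
  have coord [measurable]: "(\<lambda>g. g i) \<in> borel_measurable ?G" if "i \<in> I" for i
    using measurable_component_singleton[OF that, of "\<lambda>i. gaussian (\<sigma> i)"] by simp
  have coordZ [measurable]: "(\<lambda>z. z k) \<in> borel_measurable ?Z" if "k \<in> J" for k
    using measurable_component_singleton[OF that, of "\<lambda>_. gaussian 1"] by simp
  \<comment> \<open>\<open>a\<close> and \<open>b\<close> are the likelihood ratios of
    \<open>g\<close> shifted by \<open>h v\<close> and of \<open>z\<close> shifted by
    \<open>s\<close> times \<open>X v\<close>; \<open>f\<close> is the test statistic. The division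
    by \<open>1\<^sup>2\<close> keeps \<open>b\<close> in the shape of
    \<open>nn_integral_exp_gaussian_pair\<close>.\<close>
  define a where "a v g = exp (\<Sum>i\<in>I. h v i * g i / (\<sigma> i)\<^sup>2 - (h v i)\<^sup>2 / (2 * (\<sigma> i)\<^sup>2))" for v g
  define b where "b v z = exp (\<Sum>k\<in>J. s * X v k * z k / 1\<^sup>2 - (s * X v k)\<^sup>2 / (2 * 1\<^sup>2))" for v z
  define f where "f g w z = exp (\<Sum>k\<in>J. t * u g w k * z k)" for g w z
  have a [measurable]: "(\<lambda>x. a (F x) (E x)) \<in> borel_measurable M"
    if "F \<in> measurable M \<mu>" "E \<in> measurable M ?G" for F E and M :: "'m measure"
    unfolding a_def using measurable_compose[OF that(1) h] measurable_compose[OF that(2) coord]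
    by (intro measurable_compose[OF _ borel_measurable_exp] borel_measurable_sum borel_measurable_diff
        borel_measurable_divide borel_measurable_times borel_measurable_power borel_measurable_const) auto
  have b [measurable]: "(\<lambda>x. b (F x) (E x)) \<in> borel_measurable M"
    if "F \<in> measurable M \<mu>" "E \<in> measurable M ?Z" for F E and M :: "'m measure"
    unfolding b_def using measurable_compose[OF that(1) X] measurable_compose[OF that(2) coordZ]
    by (intro measurable_compose[OF _ borel_measurable_exp] borel_measurable_sum borel_measurable_diff
        borel_measurable_divide borel_measurable_times borel_measurable_power borel_measurable_const) auto
  have u' [measurable]: "(\<lambda>x. u (E x) (F x) k) \<in> borel_measurable M"
    if "k \<in> J" "E \<in> measurable M ?G" "F \<in> measurable M \<tau>" for F E k and M :: "'m measure"
    using measurable_compose[OF measurable_Pair[OF that(2,3)] u[OF that(1)]] by simp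
  have f [measurable]: "(\<lambda>x. f (E x) (F x) (D x)) \<in> borel_measurable M"
    if "E \<in> measurable M ?G" "F \<in> measurable M \<tau>" "D \<in> measurable M ?Z" for F E D and M :: "'m measure"
    unfolding f_def using that u' coordZ[THEN measurable_compose[OF that(3)]]
    by (intro measurable_compose[OF _ borel_measurable_exp] borel_measurable_sum
        borel_measurable_times borel_measurable_const) auto
  \<comment> \<open>The likelihood ratio of the pair, with the signal averaged over its prior
    \<mu>.\<close>
  define L where "L g z = (\<integral>\<^sup>+v. ennreal (a v g) * ennreal (b v z) \<partial>\<mu>)" for g z
  have L [measurable]: "(\<lambda>(g, z). L g z) \<in> borel_measurable (?G \<Otimes>\<^sub>M ?Z)"
    unfolding L_def by measurable

  \<comment> \<open>Under the weight \<open>b v\<close> the vector \<open>z\<close> has mean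
    \<open>s\<close> times \<open>X v\<close>, so the integral is the wanted exponential times exp
    (t^2 |u|^2 / 2). The latter factor is at least 1 and is dropped.\<close>
  have b_mgf: "ennreal (exp (t * s * (\<Sum>k\<in>J. u g w k * X v k))) \<le> (\<integral>\<^sup>+z. ennreal (b v z) * ennreal (f g w z) \<partial>?Z)"
    for v g w
  proof -
    let ?c = "\<Sum>k\<in>J. (s * X v k)\<^sup>2 / 2"
    have "ennreal (b v z) * ennreal (f g w z) =
        ennreal (exp (- ?c)) * ennreal (exp (\<Sum>k\<in>J. (s * X v k + t * u g w k) * z k))" for z
    proof -
      have "(\<Sum>k\<in>J. s * X v k * z k / 1\<^sup>2 - (s * X v k)\<^sup>2 / (2 * 1\<^sup>2)) + (\<Sum>k\<in>J. t * u g w k * z k) =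
          - ?c + (\<Sum>k\<in>J. (s * X v k + t * u g w k) * z k)"
        unfolding sum.distrib[symmetric] sum_negf[symmetric]
        by (intro sum.cong refl) (simp add: algebra_simps)
      then show ?thesis
        by (simp add: b_def f_def ennreal_mult[symmetric] exp_add[symmetric])
    qed
    then have "(\<integral>\<^sup>+z. ennreal (b v z) * ennreal (f g w z) \<partial>?Z) =
        ennreal (exp (- ?c)) * (\<integral>\<^sup>+z. ennreal (exp (\<Sum>k\<in>J. (s * X v k + t * u g w k) * z k)) \<partial>?Z)"
      by (simp add: nn_integral_cmult)
    also have "\<dots> = ennreal (exp (- ?c + (\<Sum>k\<in>J. (s * X v k + t * u g w k)\<^sup>2 * 1\<^sup>2 / 2)))"
      using fin by (subst nn_integral_exp_gaussians) (auto simp: ennreal_mult[symmetric] exp_add[symmetric])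
    also have "- ?c + (\<Sum>k\<in>J. (s * X v k + t * u g w k)\<^sup>2 * 1\<^sup>2 / 2) =
        t * s * (\<Sum>k\<in>J. u g w k * X v k) + (\<Sum>k\<in>J. (t * u g w k)\<^sup>2 / 2)"
      unfolding sum.distrib[symmetric] sum_negf[symmetric] sum_distrib_left
      by (intro sum.cong refl) (simp add: power2_sum field_simps)
    finally show ?thesis
      by (auto intro!: ennreal_leI sum_nonneg)
  qed

  \<comment> \<open>The change of measure removes the signal from the argument of \<open>u\<close>
    at the price of the weight \<open>a\<close>.\<close>
  have "(\<integral>\<^sup>+w. \<integral>\<^sup>+v. \<integral>\<^sup>+g. ennreal (exp (t * s * (\<Sum>k\<in>J. u (\<lambda>i\<in>I. g i + h v i) w k * X v k)))
      \<partial>?G \<partial>\<mu> \<partial>\<tau>) =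
    (\<integral>\<^sup>+w. \<integral>\<^sup>+v. \<integral>\<^sup>+g. ennreal (a v g) * ennreal (exp (t * s * (\<Sum>k\<in>J. u g w k * X v k))) \<partial>?G \<partial>\<mu> \<partial>\<tau>)"
  proof (rule nn_integral_cong, rule nn_integral_cong)
    fix w v assume [measurable]: "w \<in> space \<tau>"
    have "(\<lambda>g. ennreal (exp (t * s * (\<Sum>k\<in>J. u g w k * X v k)))) \<in> borel_measurable ?G"
      by measurable
    from nn_integral_shift_gaussians[OF fin(1) \<sigma> this, of "h v"]
    show "(\<integral>\<^sup>+g. ennreal (exp (t * s * (\<Sum>k\<in>J. u (\<lambda>i\<in>I. g i + h v i) w k * X v k))) \<partial>?G) =
        (\<integral>\<^sup>+g. ennreal (a v g) * ennreal (exp (t * s * (\<Sum>k\<in>J. u g w k * X v k))) \<partial>?G)"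
      unfolding a_def .
  qed
  also have "\<dots> \<le> (\<integral>\<^sup>+w. \<integral>\<^sup>+v. \<integral>\<^sup>+g. ennreal (a v g) * (\<integral>\<^sup>+z. ennreal (b v z) * ennreal (f g w z) \<partial>?Z) \<partial>?G \<partial>\<mu> \<partial>\<tau>)"
    by (intro nn_integral_mono mult_left_mono b_mgf) auto
  also have "\<dots> = (\<integral>\<^sup>+w. \<integral>\<^sup>+v. \<integral>\<^sup>+(g, z). ennreal (a v g) * (ennreal (b v z) * ennreal (f g w z)) \<partial>(?G \<Otimes>\<^sub>M ?Z) \<partial>\<mu> \<partial>\<tau>)"
  proof (intro nn_integral_cong)
    fix w v assume [measurable]: "w \<in> space \<tau>" "v \<in> space \<mu>"
    have "(\<integral>\<^sup>+(g, z). ennreal (a v g) * (ennreal (b v z) * ennreal (f g w z)) \<partial>(?G \<Otimes>\<^sub>M ?Z)) =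
        (\<integral>\<^sup>+g. \<integral>\<^sup>+z. ennreal (a v g) * (ennreal (b v z) * ennreal (f g w z)) \<partial>?Z \<partial>?G)"
    proof -
      have "(\<lambda>(g, z). ennreal (a v g) * (ennreal (b v z) * ennreal (f g w z))) \<in> borel_measurable (?G \<Otimes>\<^sub>M ?Z)"
        by measurable
      then show ?thesis
        by (subst Z.nn_integral_fst[symmetric]) simp_all
    qed
    also have "\<dots> = (\<integral>\<^sup>+g. ennreal (a v g) * (\<integral>\<^sup>+z. ennreal (b v z) * ennreal (f g w z) \<partial>?Z) \<partial>?G)"
      by (intro nn_integral_cong nn_integral_cmult) measurable
    finally show "(\<integral>\<^sup>+g. ennreal (a v g) * (\<integral>\<^sup>+z. ennreal (b v z) * ennreal (f g w z) \<partial>?Z) \<partial>?G) =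
        (\<integral>\<^sup>+(g, z). ennreal (a v g) * (ennreal (b v z) * ennreal (f g w z)) \<partial>(?G \<Otimes>\<^sub>M ?Z))" ..
  qed
  \<comment> \<open>Only the weights \<open>a\<close> and \<open>b\<close> depend on
    \<open>v\<close>, so integrating over \<open>v\<close> first produces \<open>L\<close> and
    leaves \<open>f\<close> outside.\<close>
  also have "\<dots> = (\<integral>\<^sup>+w. \<integral>\<^sup>+(g, z). \<integral>\<^sup>+v. ennreal (a v g) * (ennreal (b v z) * ennreal (f g w z)) \<partial>\<mu> \<partial>(?G \<Otimes>\<^sub>M ?Z) \<partial>\<tau>)"
    unfolding case_prod_beta by (intro nn_integral_cong \<mu>GZ.Fubini'[symmetric]) measurable
  also have "\<dots> = (\<integral>\<^sup>+w. \<integral>\<^sup>+x. ennreal (f (fst x) w (snd x)) * L (fst x) (snd x) \<partial>(?G \<Otimes>\<^sub>M ?Z) \<partial>\<tau>)"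
  proof (intro nn_integral_cong)
    fix w x assume [measurable]: "w \<in> space \<tau>" "x \<in> space (?G \<Otimes>\<^sub>M ?Z)"
    then have [measurable]: "fst x \<in> space ?G" "snd x \<in> space ?Z"
      by (auto simp: space_pair_measure)
    have "(\<integral>\<^sup>+v. ennreal (f (fst x) w (snd x)) * (ennreal (a v (fst x)) * ennreal (b v (snd x))) \<partial>\<mu>) =
        ennreal (f (fst x) w (snd x)) * L (fst x) (snd x)"
      unfolding L_def by (rule nn_integral_cmult) measurable
    then show "(case x of (g, z) \<Rightarrow> \<integral>\<^sup>+v. ennreal (a v g) * (ennreal (b v z) * ennreal (f g w z)) \<partial>\<mu>) =
        ennreal (f (fst x) w (snd x)) * L (fst x) (snd x)"
      by (simp add: case_prod_beta ac_simps)
  qed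
  also have "\<dots> = (\<integral>\<^sup>+y. ennreal (f (fst (snd y)) (fst y) (snd (snd y))) * L (fst (snd y)) (snd (snd y))
      \<partial>(\<tau> \<Otimes>\<^sub>M (?G \<Otimes>\<^sub>M ?Z)))"
    by (subst GZ.nn_integral_fst[symmetric]) (simp, measurable)
  finally have "(\<integral>\<^sup>+w. \<integral>\<^sup>+v. \<integral>\<^sup>+g. ennreal (exp (t * s * (\<Sum>k\<in>J. u (\<lambda>i\<in>I. g i + h v i) w k * X v k)))
      \<partial>?G \<partial>\<mu> \<partial>\<tau>)\<^sup>2 \<le> (\<integral>\<^sup>+y. ennreal (f (fst (snd y)) (fst y) (snd (snd y))) * L (fst (snd y)) (snd (snd y))
      \<partial>(\<tau> \<Otimes>\<^sub>M (?G \<Otimes>\<^sub>M ?Z)))\<^sup>2"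
    by (rule power_mono) simp
  also have "\<dots> \<le> (\<integral>\<^sup>+y. (ennreal (f (fst (snd y)) (fst y) (snd (snd y))))\<^sup>2 \<partial>(\<tau> \<Otimes>\<^sub>M (?G \<Otimes>\<^sub>M ?Z))) *
      (\<integral>\<^sup>+y. (L (fst (snd y)) (snd (snd y)))\<^sup>2 \<partial>(\<tau> \<Otimes>\<^sub>M (?G \<Otimes>\<^sub>M ?Z)))"
    by (rule Cauchy_Schwarz_nn_integral) measurable
  also have "\<dots> \<le> ennreal (exp (2 * t\<^sup>2)) * K"
  proof (rule mult_mono)
    show "(\<integral>\<^sup>+y. (ennreal (f (fst (snd y)) (fst y) (snd (snd y))))\<^sup>2 \<partial>(\<tau> \<Otimes>\<^sub>M (?G \<Otimes>\<^sub>M ?Z)))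
        \<le> ennreal (exp (2 * t\<^sup>2))"
    proof -
      have "(\<integral>\<^sup>+z. (ennreal (f g w z))\<^sup>2 \<partial>?Z) \<le> ennreal (exp (2 * t\<^sup>2))" for g w
      proof -
        have "(ennreal (f g w z))\<^sup>2 = ennreal (exp (\<Sum>k\<in>J. 2 * t * u g w k * z k))" for z
          by (simp add: f_def ennreal_power exp_double[symmetric] sum_distrib_left mult.assoc)
        then have "(\<integral>\<^sup>+z. (ennreal (f g w z))\<^sup>2 \<partial>?Z) = ennreal (exp (\<Sum>k\<in>J. (2 * t * u g w k)\<^sup>2 * 1\<^sup>2 / 2))"
          using fin by (simp only:) (subst nn_integral_exp_gaussians; simp)
        also have "(\<Sum>k\<in>J. (2 * t * u g w k)\<^sup>2 * 1\<^sup>2 / 2) = 2 * t\<^sup>2 * (\<Sum>k\<in>J. (u g w k)\<^sup>2)"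
          by (simp add: sum_distrib_left power_mult_distrib mult.assoc)
        also have "ennreal (exp \<dots>) \<le> ennreal (exp (2 * t\<^sup>2))"
          using mult_left_mono[OF u_norm, of "2 * t\<^sup>2" g w] by (intro ennreal_leI) simp
        finally show ?thesis .
      qed
      then have "(\<integral>\<^sup>+w. \<integral>\<^sup>+g. \<integral>\<^sup>+z. (ennreal (f g w z))\<^sup>2 \<partial>?Z \<partial>?G \<partial>\<tau>) \<le>
          (\<integral>\<^sup>+w. \<integral>\<^sup>+g. ennreal (exp (2 * t\<^sup>2)) \<partial>?G \<partial>\<tau>)"
        by (intro nn_integral_mono)
      also have "\<dots> = ennreal (exp (2 * t\<^sup>2))"
        by (simp add: G.emeasure_space_1 \<tau>.emeasure_space_1)
      also have "(\<integral>\<^sup>+w. \<integral>\<^sup>+g. \<integral>\<^sup>+z. (ennreal (f g w z))\<^sup>2 \<partial>?Z \<partial>?G \<partial>\<tau>) =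
          (\<integral>\<^sup>+w. \<integral>\<^sup>+x. (ennreal (f (fst x) w (snd x)))\<^sup>2 \<partial>(?G \<Otimes>\<^sub>M ?Z) \<partial>\<tau>)"
      proof (intro nn_integral_cong)
        fix w assume [measurable]: "w \<in> space \<tau>"
        show "(\<integral>\<^sup>+g. \<integral>\<^sup>+z. (ennreal (f g w z))\<^sup>2 \<partial>?Z \<partial>?G) =
            (\<integral>\<^sup>+x. (ennreal (f (fst x) w (snd x)))\<^sup>2 \<partial>(?G \<Otimes>\<^sub>M ?Z))"
          by (subst Z.nn_integral_fst[symmetric]) (simp, measurable)
      qed
      also have "\<dots> = (\<integral>\<^sup>+y. (ennreal (f (fst (snd y)) (fst y) (snd (snd y))))\<^sup>2 \<partial>(\<tau> \<Otimes>\<^sub>M (?G \<Otimes>\<^sub>M ?Z)))"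
        by (subst GZ.nn_integral_fst[symmetric]) (simp, measurable)
      finally show ?thesis .
    qed
    show "(\<integral>\<^sup>+y. (L (fst (snd y)) (snd (snd y)))\<^sup>2 \<partial>(\<tau> \<Otimes>\<^sub>M (?G \<Otimes>\<^sub>M ?Z))) \<le> K"
    proof -
      define A where "A v v' x = ennreal (a v (fst x)) * ennreal (b v (snd x)) *
        (ennreal (a v' (fst x)) * ennreal (b v' (snd x)))" for v v' x
      have [measurable]: "(\<lambda>y. A (E y) (F y) (D y)) \<in> borel_measurable M"
        if "E \<in> measurable M \<mu>" "F \<in> measurable M \<mu>" "D \<in> measurable M (?G \<Otimes>\<^sub>M ?Z)" for E F D and M :: "'m measure"
        using that unfolding A_def by measurable
      \<comment> \<open>The square of an average over \<open>v\<close> is a double average over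
        independent copies \<open>v\<close> and \<open>v'\<close>; the Gaussian integral of the
        product is then explicit.\<close>
      have sq: "(L (fst x) (snd x))\<^sup>2 = (\<integral>\<^sup>+v'. \<integral>\<^sup>+v. A v v' x \<partial>\<mu> \<partial>\<mu>)" if "x \<in> space (?G \<Otimes>\<^sub>M ?Z)" for x
      proof -
        have [measurable]: "fst x \<in> space ?G" "snd x \<in> space ?Z"
          using that by (auto simp: space_pair_measure)
        show ?thesis
          unfolding A_def power2_eq_square L_def
          by (subst nn_integral_multc) (auto simp: nn_integral_cmult[symmetric])
      qed
      have A: "(\<integral>\<^sup>+x. A v v' x \<partial>(?G \<Otimes>\<^sub>M ?Z)) =
          ennreal (exp ((\<Sum>i\<in>I. h v i * h v' i / (\<sigma> i)\<^sup>2) + s\<^sup>2 * (\<Sum>k\<in>J. X v k * X v' k)))"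
        if [measurable]: "v \<in> space \<mu>" "v' \<in> space \<mu>" for v v'
      proof -
        have "(\<integral>\<^sup>+x. A v v' x \<partial>(?G \<Otimes>\<^sub>M ?Z)) = (\<integral>\<^sup>+g. \<integral>\<^sup>+z. A v v' (g, z) \<partial>?Z \<partial>?G)"
          by (rule Z.nn_integral_fst[symmetric]) measurable
        also have "\<dots> = (\<integral>\<^sup>+g. \<integral>\<^sup>+z. (ennreal (a v g) * ennreal (a v' g)) * (ennreal (b v z) * ennreal (b v' z)) \<partial>?Z \<partial>?G)"
          by (simp add: A_def ac_simps)
        also have "\<dots> = (\<integral>\<^sup>+g. ennreal (a v g) * ennreal (a v' g) \<partial>?G) * (\<integral>\<^sup>+z. ennreal (b v z) * ennreal (b v' z) \<partial>?Z)"
          by (simp add: nn_integral_cmult nn_integral_multc)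
        also have "(\<integral>\<^sup>+g. ennreal (a v g) * ennreal (a v' g) \<partial>?G) = ennreal (exp (\<Sum>i\<in>I. h v i * h v' i / (\<sigma> i)\<^sup>2))"
          unfolding a_def by (intro nn_integral_exp_gaussian_pair fin \<sigma>)
        also have "(\<integral>\<^sup>+z. ennreal (b v z) * ennreal (b v' z) \<partial>?Z) =
            ennreal (exp (\<Sum>k\<in>J. (s * X v k) * (s * X v' k) / 1\<^sup>2))"
          unfolding b_def by (rule nn_integral_exp_gaussian_pair) (simp_all add: fin)
        also have "(\<Sum>k\<in>J. (s * X v k) * (s * X v' k) / 1\<^sup>2) = s\<^sup>2 * (\<Sum>k\<in>J. X v k * X v' k)"
          by (simp add: power2_eq_square sum_distrib_left ac_simps)
        finally show ?thesis
          by (simp add: exp_add ennreal_mult)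
      qed
      have "(\<integral>\<^sup>+y. (L (fst (snd y)) (snd (snd y)))\<^sup>2 \<partial>(\<tau> \<Otimes>\<^sub>M (?G \<Otimes>\<^sub>M ?Z))) =
          (\<integral>\<^sup>+w. \<integral>\<^sup>+x. (L (fst x) (snd x))\<^sup>2 \<partial>(?G \<Otimes>\<^sub>M ?Z) \<partial>\<tau>)"
        by (subst GZ.nn_integral_fst[symmetric]) (simp, measurable)
      also have "\<dots> = (\<integral>\<^sup>+x. \<integral>\<^sup>+v'. \<integral>\<^sup>+v. A v v' x \<partial>\<mu> \<partial>\<mu> \<partial>(?G \<Otimes>\<^sub>M ?Z))"
        by (simp add: \<tau>.emeasure_space_1 sq cong: nn_integral_cong)
      also have "\<dots> = (\<integral>\<^sup>+v'. \<integral>\<^sup>+x. \<integral>\<^sup>+v. A v v' x \<partial>\<mu> \<partial>(?G \<Otimes>\<^sub>M ?Z) \<partial>\<mu>)"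
        by (rule \<mu>GZ.Fubini') measurable
      also have "\<dots> = (\<integral>\<^sup>+v'. \<integral>\<^sup>+v. \<integral>\<^sup>+x. A v v' x \<partial>(?G \<Otimes>\<^sub>M ?Z) \<partial>\<mu> \<partial>\<mu>)"
        by (intro nn_integral_cong \<mu>GZ.Fubini') measurable
      also have "\<dots> = (\<integral>\<^sup>+v'. \<integral>\<^sup>+v. ennreal (exp ((\<Sum>i\<in>I. h v i * h v' i / (\<sigma> i)\<^sup>2) +
          s\<^sup>2 * (\<Sum>k\<in>J. X v k * X v' k))) \<partial>\<mu> \<partial>\<mu>)"
        by (intro nn_integral_cong A)
      finally show ?thesis
        using overlap by simp
    qed
  qed auto
  finally show ?thesis .
qed

section \<open>Synchronization\<close>

text \<open>Row norms are at most 1, and their squares sum to \<open>d\<close> by summing over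
  columns instead, so all equal 1. Bessel's inequality for the sum and the difference of two basis
  vectors then bounds the inner product of two distinct rows from both sides by 0.\<close>

lemma orthogonal_group_rows:
  assumes A: "A \<in> orthogonal_group d" and "a < d" "b < d"
  shows "(\<Sum>c<d. A (a, c) * A (b, c)) = (if a = b then 1 else 0)"
proof -
  have norm: "(\<Sum>c<d. (A (a, c))\<^sup>2) = 1" if "a < d" for a
  proof -
    have "(\<Sum>a<d. 1 - (\<Sum>c<d. (A (a, c))\<^sup>2)) = real d - (\<Sum>c<d. \<Sum>a<d. (A (a, c))\<^sup>2)"
      by (subst sum.swap) (simp add: sum_subtractf)
    also have "(\<Sum>c<d. \<Sum>a<d. (A (a, c))\<^sup>2) = (\<Sum>c<d. 1)"
      using A by (intro sum.cong refl) (auto simp: orthogonal_group_def power2_eq_square)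
    finally have "(\<Sum>a<d. 1 - (\<Sum>c<d. (A (a, c))\<^sup>2)) = 0"
      by simp
    then have "\<forall>a\<in>{..<d}. 1 - (\<Sum>c<d. (A (a, c))\<^sup>2) = 0"
      using orthogonal_group_row_norm[OF A] by (subst (asm) sum_nonneg_eq_0_iff) auto
    then show ?thesis
      using that by auto
  qed
  show ?thesis
  proof (cases "a = b")
    case True
    then show ?thesis
      using norm[OF \<open>a < d\<close>] by (simp add: power2_eq_square)
  next
    case False
    have "2 * e * (\<Sum>c<d. A (a, c) * A (b, c)) \<le> 0" if "e\<^sup>2 = 1" for e
    proof -
      define v where "v x = (if x = a then 1 else 0) + (if x = b then e else 0)" for x
      have "(\<Sum>x<d. v x * A (x, c)) = A (a, c) + e * A (b, c)" for c
      proof -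
        have "(\<Sum>x<d. v x * A (x, c)) =
            (\<Sum>x<d. (if x = a then A (a, c) else 0) + (if x = b then e * A (b, c) else 0))"
          by (intro sum.cong refl) (auto simp: v_def algebra_simps)
        then show ?thesis
          using assms by (simp add: sum.distrib)
      qed
      moreover have "(\<Sum>x<d. (v x)\<^sup>2) = (\<Sum>x<d. (if x = a then 1 else 0) + (if x = b then e\<^sup>2 else 0))"
        using False by (intro sum.cong refl) (auto simp: v_def)
      ultimately have "(\<Sum>c<d. (A (a, c) + e * A (b, c))\<^sup>2) \<le> 2"
        using orthogonal_group_Bessel[OF A, of v] assms that by (simp add: sum.distrib)
      moreover have "(\<Sum>c<d. (A (a, c) + e * A (b, c))\<^sup>2) =
          (\<Sum>c<d. (A (a, c))\<^sup>2) + e\<^sup>2 * (\<Sum>c<d. (A (b, c))\<^sup>2) + 2 * e * (\<Sum>c<d. A (a, c) * A (b, c))"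
        by (simp add: power2_sum power_mult_distrib sum.distrib sum_distrib_left ac_simps)
      ultimately show ?thesis
        using norm assms that by simp
    qed
    from this[of 1] this[of "- 1"] False show ?thesis
      by simp
  qed
qed

text \<open>Needed at two scales: for matrices stored row by row, and for a column index of
  \<open>U\<close> split into block number and position in the block.\<close>

lemma sum_div_mod:
  fixes F :: "nat \<Rightarrow> nat \<Rightarrow> 'a :: comm_monoid_add"
  shows "(\<Sum>k<r * c. F (k div c) (k mod c)) = (\<Sum>p<r. \<Sum>q<c. F p q)"
proof -
  have "(\<Sum>k<r * c. F (k div c) (k mod c)) = (\<Sum>(p, q)\<in>{..<r} \<times> {..<c}. F p q)"
  proof (rule sum.reindex_bij_witness[of _ "\<lambda>(p, q). p * c + q" "\<lambda>k. (k div c, k mod c)"])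
    fix k assume k: "k \<in> {..<r * c}"
    then have "0 < c"
      by (cases c) auto
    with k show "(k div c, k mod c) \<in> {..<r} \<times> {..<c}"
      by (auto simp: less_mult_imp_div_less)
  next
    fix x assume "x \<in> {..<r} \<times> {..<c}"
    then obtain p q where [simp]: "x = (p, q)" and pq: "p < r" "q < c"
      by auto
    have "p * c + q < Suc p * c"
      using pq by simp
    also have "\<dots> \<le> r * c"
      using pq by (intro mult_right_mono) auto
    finally show "(case x of (p, q) \<Rightarrow> p * c + q) \<in> {..<r * c}"
      by simp
  qed auto
  then show ?thesis
    by (simp add: sum.cartesian_product)
qed

section \<open>The GOE as a family of independent Gaussians\<close>

definition upper_triangle :: "nat \<Rightarrow> (nat \<times> nat) set" where
  "upper_triangle m = {(p, q). p \<le> q \<and> q < m}"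

definition goe_sd :: "nat \<times> nat \<Rightarrow> real" where
  "goe_sd i = (if fst i = snd i then sqrt 2 else 1)"

lemma finite_upper_triangle: "finite (upper_triangle m)"
  by (rule finite_subset[of _ "{..<m} \<times> {..<m}"]) (auto simp: upper_triangle_def)

lemma goe_entries_eq: "goe_entries m = PiM (upper_triangle m) (\<lambda>i. gaussian (goe_sd i))"
  unfolding goe_entries_def upper_triangle_def
  by (intro PiM_cong refl) (simp add: goe_sd_def case_prod_beta)

text \<open>The doubled variance on the diagonal is what makes this exact: the full sum counts every
  off-diagonal pair twice, while a diagonal entry is weighted by 1/2.\<close>

lemma sum_upper_triangle:
  fixes F :: "nat \<Rightarrow> nat \<Rightarrow> real"
  assumes sym: "\<And>p q. F p q = F q p"
  shows "(\<Sum>i\<in>upper_triangle m. F (fst i) (snd i) / (goe_sd i)\<^sup>2) = (\<Sum>p<m. \<Sum>q<m. F p q) / 2"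
proof -
  define T where "T p q = (if p \<le> q then F p q / (goe_sd (p, q))\<^sup>2 else 0)" for p q
  have "(\<Sum>i\<in>upper_triangle m. F (fst i) (snd i) / (goe_sd i)\<^sup>2) = (\<Sum>i\<in>{..<m} \<times> {..<m}. T (fst i) (snd i))"
    by (rule sum.mono_neutral_cong_left) (auto simp: T_def upper_triangle_def)
  also have "\<dots> = (\<Sum>p<m. \<Sum>q<m. T p q)"
    by (simp add: sum.cartesian_product case_prod_beta)
  finally have eq: "(\<Sum>i\<in>upper_triangle m. F (fst i) (snd i) / (goe_sd i)\<^sup>2) = (\<Sum>p<m. \<Sum>q<m. T p q)" .
  have "(\<Sum>p<m. \<Sum>q<m. F p q) = (\<Sum>p<m. \<Sum>q<m. T p q + T q p)"
    using sym by (intro sum.cong refl) (auto simp: T_def goe_sd_def)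
  also have "\<dots> = (\<Sum>p<m. \<Sum>q<m. T p q) + (\<Sum>p<m. \<Sum>q<m. T q p)"
    by (simp add: sum.distrib)
  also have "(\<Sum>p<m. \<Sum>q<m. T q p) = (\<Sum>p<m. \<Sum>q<m. T p q)"
    by (rule sum.swap)
  finally show ?thesis
    using eq by simp
qed

text \<open>The matrix \<Theta> before it is flattened into coordinates, so that its symmetry can be
  stated.\<close>

definition gram :: "nat \<Rightarrow> nat \<Rightarrow> real \<Rightarrow> (nat \<Rightarrow> matrix) \<Rightarrow> nat \<Rightarrow> nat \<Rightarrow> real" where
  "gram n d l V p q = l / sqrt (real n) * (\<Sum>c<d. stacked d V c p * stacked d V c q)"

lemma gram_commute: "gram n d l V p q = gram n d l V q p"
  by (simp add: gram_def mult.commute)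

lemma signal_eq: "signal n d l V = row_major (n * d) (n * d) (gram n d l V)"
  by (simp only: signal_def gram_def[abs_def])

lemma sum_signal_mult:
  "(\<Sum>k<sync_dim n d. signal n d l V k * signal n d l W k) =
    (\<Sum>p<n * d. \<Sum>q<n * d. gram n d l V p q * gram n d l W p q)"
proof -
  have "(\<Sum>k<sync_dim n d. signal n d l V k * signal n d l W k) =
      (\<Sum>k<(n * d) * (n * d). gram n d l V (k div (n * d)) (k mod (n * d)) * gram n d l W (k div (n * d)) (k mod (n * d)))"
    by (intro sum.cong) (auto simp: sync_dim_def signal_eq row_major_def)
  also have "\<dots> = (\<Sum>p<n * d. \<Sum>q<n * d. gram n d l V p q * gram n d l W p q)"
    by (rule sum_div_mod[of "\<lambda>p q. gram n d l V p q * gram n d l W p q"])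
  finally show ?thesis .
qed

text \<open>The identity <U^T U, T^T T> = |U T^T|^2 in Frobenius norm. It brings the overlap of two
  signals into the form treated in \<open>haar_overlap_exp_moment\<close>.\<close>

lemma sum_gram_mult:
  "(\<Sum>p<n * d. \<Sum>q<n * d. gram n d l V p q * gram n d l W p q) =
    l\<^sup>2 / real n * (\<Sum>a<d. \<Sum>b<d. (\<Sum>i<n. \<Sum>c<d. V i (a, c) * W i (b, c))\<^sup>2)"
proof -
  let ?U = "stacked d V" and ?T = "stacked d W"
  have inner: "(\<Sum>p<n * d. ?U a p * ?T b p) = (\<Sum>i<n. \<Sum>c<d. V i (a, c) * W i (b, c))" for a b
    unfolding stacked_def by (rule sum_div_mod)
  have "(\<Sum>p<n * d. \<Sum>q<n * d. (\<Sum>a<d. ?U a p * ?U a q) * (\<Sum>b<d. ?T b p * ?T b q)) =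
      (\<Sum>p<n * d. \<Sum>q<n * d. \<Sum>a<d. \<Sum>b<d. (?U a p * ?T b p) * (?U a q * ?T b q))"
    by (simp add: sum_product ac_simps)
  also have "\<dots> = (\<Sum>p<n * d. \<Sum>a<d. \<Sum>b<d. \<Sum>q<n * d. (?U a p * ?T b p) * (?U a q * ?T b q))"
    by (rule sum.cong[OF refl], rule trans[OF sum.swap], rule sum.cong[OF refl], rule sum.swap)
  also have "\<dots> = (\<Sum>a<d. \<Sum>b<d. \<Sum>p<n * d. \<Sum>q<n * d. (?U a p * ?T b p) * (?U a q * ?T b q))"
    by (rule trans[OF sum.swap], rule sum.cong[OF refl], rule sum.swap)
  also have "\<dots> = (\<Sum>a<d. \<Sum>b<d. (\<Sum>i<n. \<Sum>c<d. V i (a, c) * W i (b, c))\<^sup>2)"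
    by (simp add: power2_eq_square sum_product flip: inner)
  finally have sum: "(\<Sum>p<n * d. \<Sum>q<n * d. (\<Sum>a<d. ?U a p * ?U a q) * (\<Sum>b<d. ?T b p * ?T b q)) =
      (\<Sum>a<d. \<Sum>b<d. (\<Sum>i<n. \<Sum>c<d. V i (a, c) * W i (b, c))\<^sup>2)" .
  have "gram n d l V p q * gram n d l W p q =
      l\<^sup>2 / real n * ((\<Sum>a<d. ?U a p * ?U a q) * (\<Sum>b<d. ?T b p * ?T b q))" for p q
    by (simp add: gram_def power2_eq_square)
  then show ?thesis
    by (simp only: sum_distrib_left[symmetric] sum)
qed

text \<open>Each block has orthonormal rows, so U U^T is \<open>n\<close> times the identity. Hence
  the norm of \<Theta> is almost surely constant.\<close>

lemma sum_signal_square: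
  assumes "\<forall>i<n. V i \<in> orthogonal_group d"
  shows "(\<Sum>k<sync_dim n d. (signal n d l V k)\<^sup>2) = l\<^sup>2 * real n * real d"
proof -
  have "(\<Sum>i<n. \<Sum>c<d. V i (a, c) * V i (b, c)) = (if a = b then real n else 0)" if "a < d" "b < d" for a b
    using assms that by (simp add: orthogonal_group_rows)
  then have "(\<Sum>a<d. \<Sum>b<d. (\<Sum>i<n. \<Sum>c<d. V i (a, c) * V i (b, c))\<^sup>2) = (\<Sum>a<d. \<Sum>b<d. if a = b then (real n)\<^sup>2 else 0)"
    by (intro sum.cong refl) simp
  also have "\<dots> = real d * (real n)\<^sup>2"
    by simp
  finally show ?thesis
    using sum_signal_mult[of n d l V V] sum_gram_mult[of n d l V V]
    by (cases "n = 0") (simp_all add: power2_eq_square)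
qed

text \<open>Since \<Theta> is symmetric, adding it amounts to shifting the independent entries of
  the noise. This puts the planted observation into the form required by
  \<open>recovery_exp_moment\<close>.\<close>

lemma observation_eq_noise:
  "observation n d l V g =
    noise (n * d) (\<lambda>i\<in>upper_triangle (n * d). g i + gram n d l V (fst i) (snd i))"
proof
  fix k
  show "observation n d l V g k =
      noise (n * d) (\<lambda>i\<in>upper_triangle (n * d). g i + gram n d l V (fst i) (snd i)) k"
  proof (cases "k < (n * d) * (n * d)")
    case True
    then have "0 < n * d"
      by (cases "n * d") auto
    then have lt: "k div (n * d) < n * d" "k mod (n * d) < n * d"
      using True by (auto simp: less_mult_imp_div_less)
    have "gram n d l V (min p q) (max p q) = gram n d l V p q" for p q
      by (simp add: min_def max_def gram_commute)
    moreover have "min p q \<le> max p q" for p q :: nat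
      by simp
    ultimately show ?thesis
      using True lt
      by (simp add: observation_def noise_def row_major_def signal_eq sync_dim_def upper_triangle_def)
  qed (simp add: observation_def noise_def row_major_def sync_dim_def)
qed

text \<open>Jensen's inequality through the tangent line of exp at \<beta> c. Touching there rather
  than at the mean lets \<open>c\<close> be any lower bound of the mean.\<close>

lemma (in prob_space) exp_le_nn_integral_exp:
  assumes X: "integrable M X" and c: "c \<le> expectation X" and \<beta>: "0 \<le> \<beta>"
  shows "ennreal (exp (\<beta> * c)) \<le> (\<integral>\<^sup>+x. ennreal (exp (\<beta> * X x)) \<partial>M)"
proof (cases "(\<integral>\<^sup>+x. ennreal (exp (\<beta> * X x)) \<partial>M) = \<infinity>")
  case False
  have [measurable]: "X \<in> borel_measurable M"
    using X by (rule borel_measurable_integrable)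
  have int: "integrable M (\<lambda>x. exp (\<beta> * X x))"
    using False by (intro integrableI_nonneg) (auto simp: top.not_eq_extremum)
  have "exp (\<beta> * c) \<le> exp (\<beta> * c) * (1 + \<beta> * (expectation X - c))"
    using c \<beta> by simp
  also have "\<dots> = expectation (\<lambda>x. exp (\<beta> * c) * (1 + \<beta> * (X x - c)))"
    using X by (simp add: prob_space)
  also have "\<dots> \<le> expectation (\<lambda>x. exp (\<beta> * X x))"
  proof (rule integral_mono)
    show "exp (\<beta> * c) * (1 + \<beta> * (X x - c)) \<le> exp (\<beta> * X x)" for x
    proof -
      have "exp (\<beta> * c) * (1 + \<beta> * (X x - c)) \<le> exp (\<beta> * c) * exp (\<beta> * (X x - c))"
        by (intro mult_left_mono exp_ge_add_one_self) auto
      then show ?thesis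
        by (simp add: exp_add[symmetric] algebra_simps)
    qed
  qed (use X int in auto)
  finally show ?thesis
    using int by (simp add: nn_integral_eq_integral ennreal_leI)
qed simp

text \<open>Jensen's inequality bounds the moment in \<open>recovery_exp_moment\<close> from below,
  and the Haar overlap moment bounds its square from above. The squaring gives the factor 2 on the
  left, and l sqrt (n d) is the norm of \<Theta>.\<close>

lemma cosine_bound_nonasymptotic:
  assumes haar: "haar_orthogonal d \<mu>" and "0 < n" "0 < d" "0 < l" "0 \<le> s" "0 \<le> t"
    and r: "l\<^sup>2 * (1 + 2 * s\<^sup>2) < 1" and "0 < c"
    and recovery: "c \<le> (\<integral>((V, g), w).
            cosine (sync_dim n d) (final (sync_dim n d) prog (observation n d l V g) w) (signal n d l V)
          \<partial>((PiM {..<n} (\<lambda>_. \<mu>) \<Otimes>\<^sub>M goe_entries (n * d)) \<Otimes>\<^sub>M tape))"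
  shows "exp (2 * t * s * l * sqrt (real n * real d) * c) \<le>
    exp (2 * t\<^sup>2) * (1 / sqrt (1 - l\<^sup>2 * (1 + 2 * s\<^sup>2))) ^ d\<^sup>2"
proof -
  let ?V = "PiM {..<n} (\<lambda>_. \<mu>)"
  let ?I = "upper_triangle (n * d)"
  let ?G = "PiM ?I (\<lambda>i. gaussian (goe_sd i))"
  let ?N = "sync_dim n d"
  have sd: "0 < goe_sd i" for i
    by (simp add: goe_sd_def)
  have pr: "prob_space \<mu>"
    using haar by (simp add: haar_orthogonal_def)
  interpret V: prob_space ?V
    using pr by (rule prob_space_PiM)
  interpret G: prob_space ?G
    using sd by (intro prob_space_PiM prob_space_normal_density)
  interpret T: prob_space tape
    unfolding tape_def by (intro prob_space_PiM prob_space_normal_density) simp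
  interpret VG: pair_prob_space ?V ?G ..
  interpret VGT: pair_prob_space "?V \<Otimes>\<^sub>M ?G" tape ..
  define X where "X V = signal n d l V" for V
  define h where "h V i = gram n d l V (fst i) (snd i)" for V i
  \<comment> \<open>The estimator is expressed through the independent noise entries and then
    normalized. If the output vanishes, division by 0 makes \<open>u\<close> zero, in agreement with
    the convention in \<open>cosine\<close>.\<close>
  define E where "E g w k = final ?N prog (noise (n * d) g) w k" for g w k
  define u where "u g w k = E g w k / sqrt (\<Sum>j<?N. (E g w j)\<^sup>2)" for g w k
  define R where "R = l * sqrt (real n * real d)"
  have stacked: "(\<lambda>V. stacked d V a p) \<in> borel_measurable ?V" if "a < d" "p < n * d" for a p
    unfolding stacked_def using that \<open>0 < d\<close>
    by (intro measurable_block_entry[OF haar]) (auto simp: less_mult_imp_div_less)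
  have gram: "(\<lambda>V. gram n d l V p q) \<in> borel_measurable ?V" if "p < n * d" "q < n * d" for p q
    unfolding gram_def using that stacked
    by (intro borel_measurable_times borel_measurable_sum borel_measurable_const) auto
  have h: "(\<lambda>V. h V i) \<in> borel_measurable ?V" if "i \<in> ?I" for i
    unfolding h_def using that by (intro gram) (auto simp: upper_triangle_def)
  have X: "(\<lambda>V. X V k) \<in> borel_measurable ?V" if "k \<in> {..<?N}" for k
  proof -
    have "k < (n * d) * (n * d)"
      using that by (simp add: sync_dim_def)
    then show ?thesis
      using \<open>0 < n\<close> \<open>0 < d\<close>
      by (simp add: X_def signal_eq row_major_def) (intro gram; simp add: less_mult_imp_div_less)
  qed
  have E: "(\<lambda>x. E (fst x) (snd x) k) \<in> borel_measurable (?G \<Otimes>\<^sub>M tape)" for k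
    unfolding E_def
  proof (rule borel_measurable_final)
    show "(\<lambda>x. noise (n * d) (fst x) k) \<in> borel_measurable (?G \<Otimes>\<^sub>M tape)" if "k < ?N" for k
    proof -
      have "0 < n * d" and k: "k < (n * d) * (n * d)"
        using \<open>0 < n\<close> \<open>0 < d\<close> that by (auto simp: sync_dim_def)
      then have "(min (k div (n * d)) (k mod (n * d)), max (k div (n * d)) (k mod (n * d))) \<in> ?I"
        by (auto simp: less_mult_imp_div_less upper_triangle_def)
      from measurable_component_singleton[OF this, of "\<lambda>i. gaussian (goe_sd i)"] show ?thesis
        using k by (auto simp: noise_def row_major_def intro!: measurable_compose[OF measurable_fst])
    qed
    show "(\<lambda>x. snd x k) \<in> borel_measurable (?G \<Otimes>\<^sub>M tape)" for k
      unfolding tape_def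
      by (rule measurable_compose[OF measurable_snd])
        (use measurable_component_singleton[of k UNIV "\<lambda>_. gaussian 1"] in simp)
  qed
  have u: "(\<lambda>(g, w). u g w k) \<in> borel_measurable (?G \<Otimes>\<^sub>M tape)" for k
    unfolding case_prod_beta u_def using E
    by (intro borel_measurable_divide measurable_compose[OF _ borel_measurable_sqrt] borel_measurable_sum borel_measurable_power) auto
  have u_norm: "(\<Sum>k<?N. (u g w k)\<^sup>2) \<le> 1" for g w
  proof -
    have "(\<Sum>k<?N. (u g w k)\<^sup>2) = (\<Sum>k<?N. (E g w k)\<^sup>2) / (\<Sum>k<?N. (E g w k)\<^sup>2)"
      by (simp add: u_def power_divide sum_nonneg flip: sum_divide_distrib)
    then show ?thesis
      by simp
  qed
  \<comment> \<open>The summand 1/2 comes from the GOE observation, by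
    \<open>sum_upper_triangle\<close>, and \<open>s\<^sup>2\<close> from the extra one; the last
    factor is that of \<open>sum_gram_mult\<close>.\<close>
  define \<kappa> where "\<kappa> = (1 / 2 + s\<^sup>2) * (l\<^sup>2 / real n)"
  have \<kappa>: "0 \<le> \<kappa>" "2 * \<kappa> * real n = l\<^sup>2 * (1 + 2 * s\<^sup>2)"
    using \<open>0 < n\<close> by (auto simp: \<kappa>_def field_simps)
  let ?K = "ennreal ((1 / sqrt (1 - l\<^sup>2 * (1 + 2 * s\<^sup>2))) ^ d\<^sup>2)"
  have overlap: "(\<Sum>i\<in>?I. h V i * h W i / (goe_sd i)\<^sup>2) + s\<^sup>2 * (\<Sum>k\<in>{..<?N}. X V k * X W k) =
      \<kappa> * (\<Sum>a<d. \<Sum>b<d. (\<Sum>i<n. \<Sum>c<d. V i (a, c) * W i (b, c))\<^sup>2)" for V W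
  proof -
    have "(\<Sum>i\<in>?I. h V i * h W i / (goe_sd i)\<^sup>2) = (\<Sum>p<n * d. \<Sum>q<n * d. gram n d l V p q * gram n d l W p q) / 2"
      unfolding h_def by (rule sum_upper_triangle) (metis gram_commute)
    moreover have "x / 2 + s\<^sup>2 * x = (1 / 2 + s\<^sup>2) * x" for x
      by (simp add: algebra_simps)
    ultimately show ?thesis
      by (simp only: X_def sum_signal_mult sum_gram_mult \<kappa>_def mult.assoc)
  qed
  have "(\<integral>\<^sup>+W. \<integral>\<^sup>+V. ennreal (exp ((\<Sum>i\<in>?I. h V i * h W i / (goe_sd i)\<^sup>2) +
      s\<^sup>2 * (\<Sum>k\<in>{..<?N}. X V k * X W k))) \<partial>?V \<partial>?V) \<le> (\<integral>\<^sup>+W. ?K \<partial>?V)"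
  proof (rule nn_integral_mono_AE)
    show "AE W in ?V. (\<integral>\<^sup>+V. ennreal (exp ((\<Sum>i\<in>?I. h V i * h W i / (goe_sd i)\<^sup>2) +
        s\<^sup>2 * (\<Sum>k\<in>{..<?N}. X V k * X W k))) \<partial>?V) \<le> ?K"
      using AE_blocks_orthogonal[OF haar, of n]
    proof eventually_elim
      case (elim W)
      then show ?case
        using haar_overlap_exp_moment[OF haar \<kappa>(1) _ elim] r unfolding overlap \<kappa>(2) by simp
    qed
  qed
  also have "\<dots> = ?K"
    by (simp add: V.emeasure_space_1)
  finally have K: "(\<integral>\<^sup>+W. \<integral>\<^sup>+V. ennreal (exp ((\<Sum>i\<in>?I. h V i * h W i / (goe_sd i)\<^sup>2) +
      s\<^sup>2 * (\<Sum>k\<in>{..<?N}. X V k * X W k))) \<partial>?V \<partial>?V) \<le> ?K" .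
  have moment: "(\<integral>\<^sup>+w. \<integral>\<^sup>+V. \<integral>\<^sup>+g. ennreal (exp (t * s * (\<Sum>k\<in>{..<?N}. u (\<lambda>i\<in>?I. g i + h V i) w k * X V k)))
      \<partial>?G \<partial>?V \<partial>tape)\<^sup>2 \<le> ennreal (exp (2 * t\<^sup>2)) * ?K"
    by (rule recovery_exp_moment[OF finite_upper_triangle _ sd V.prob_space_axioms T.prob_space_axioms h X u u_norm K]) auto

  define \<Phi> where "\<Phi> = (\<lambda>((V, g), w). cosine ?N (final ?N prog (observation n d l V g) w) (signal n d l V))"
  have \<Phi>: "\<Phi> ((V, g), w) = (\<Sum>k<?N. u (\<lambda>i\<in>?I. g i + h V i) w k * X V k) / sqrt (\<Sum>k<?N. (X V k)\<^sup>2)" for V g w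
    by (simp add: \<Phi>_def cosine_def u_def E_def X_def h_def observation_eq_noise sum_divide_distrib)
  have c: "c \<le> VGT.expectation \<Phi>"
    using recovery by (simp add: \<Phi>_def goe_entries_eq)
  \<comment> \<open>A Bochner integral defaults to 0 for a non-integrable function, so its lower
    bound c > 0 yields integrability, and with it joint measurability.\<close>
  have int: "integrable ((?V \<Otimes>\<^sub>M ?G) \<Otimes>\<^sub>M tape) \<Phi>"
    using c \<open>0 < c\<close> not_integrable_integral_eq[of "(?V \<Otimes>\<^sub>M ?G) \<Otimes>\<^sub>M tape" \<Phi>] by force
  then have meas [measurable]: "\<Phi> \<in> borel_measurable ((?V \<Otimes>\<^sub>M ?G) \<Otimes>\<^sub>M tape)"
    by (rule borel_measurable_integrable)
  have "ennreal (exp (t * s * R * c)) \<le> (\<integral>\<^sup>+x. ennreal (exp (t * s * R * \<Phi> x)) \<partial>((?V \<Otimes>\<^sub>M ?G) \<Otimes>\<^sub>M tape))"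
    using assms by (intro VGT.exp_le_nn_integral_exp int c) (simp add: R_def)
  also have "\<dots> = (\<integral>\<^sup>+w. \<integral>\<^sup>+x. ennreal (exp (t * s * R * \<Phi> (x, w))) \<partial>(?V \<Otimes>\<^sub>M ?G) \<partial>tape)"
    by (rule VGT.nn_integral_snd[symmetric]) measurable
  also have "\<dots> = (\<integral>\<^sup>+w. \<integral>\<^sup>+V. \<integral>\<^sup>+g. ennreal (exp (t * s * R * \<Phi> ((V, g), w))) \<partial>?G \<partial>?V \<partial>tape)"
  proof (rule nn_integral_cong)
    fix w assume [measurable]: "w \<in> space tape"
    show "(\<integral>\<^sup>+x. ennreal (exp (t * s * R * \<Phi> (x, w))) \<partial>(?V \<Otimes>\<^sub>M ?G)) =
        (\<integral>\<^sup>+V. \<integral>\<^sup>+g. ennreal (exp (t * s * R * \<Phi> ((V, g), w))) \<partial>?G \<partial>?V)"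
      by (rule G.nn_integral_fst[symmetric]) measurable
  qed
  also have "\<dots> = (\<integral>\<^sup>+w. \<integral>\<^sup>+V. \<integral>\<^sup>+g. ennreal (exp (t * s * (\<Sum>k\<in>{..<?N}. u (\<lambda>i\<in>?I. g i + h V i) w k * X V k)))
      \<partial>?G \<partial>?V \<partial>tape)"
  \<comment> \<open>On orthogonal blocks the norm of the signal is the nonzero constant
    \<open>R\<close>, which cancels the denominator left in the cosine.\<close>
  proof (rule nn_integral_cong, rule nn_integral_cong_AE)
    fix w
    show "AE V in ?V. (\<integral>\<^sup>+g. ennreal (exp (t * s * R * \<Phi> ((V, g), w))) \<partial>?G) =
        (\<integral>\<^sup>+g. ennreal (exp (t * s * (\<Sum>k\<in>{..<?N}. u (\<lambda>i\<in>?I. g i + h V i) w k * X V k))) \<partial>?G)"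
      using AE_blocks_orthogonal[OF haar, of n]
    proof eventually_elim
      case (elim V)
      have "sqrt (\<Sum>k<?N. (X V k)\<^sup>2) = R"
        using sum_signal_square[OF elim, of l] \<open>0 < l\<close> by (simp add: X_def R_def real_sqrt_mult)
      moreover have "R \<noteq> 0"
        using assms by (simp add: R_def)
      ultimately show ?case
        by (simp add: \<Phi> mult.assoc)
    qed
  qed
  finally have "(ennreal (exp (t * s * R * c)))\<^sup>2 \<le> ennreal (exp (2 * t\<^sup>2)) * ?K"
    using moment by (meson order.trans power_mono zero_le)
  then have "ennreal (exp (2 * (t * s * R * c))) \<le> ennreal (exp (2 * t\<^sup>2) * (1 / sqrt (1 - l\<^sup>2 * (1 + 2 * s\<^sup>2))) ^ d\<^sup>2)"
    using r by (simp add: ennreal_power exp_double ennreal_mult)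
  then show ?thesis
    using r by (subst (asm) ennreal_le_iff) (auto simp: R_def ac_simps)
qed

section \<open>The asymptotic contradiction\<close>

theorem theorem2p16:
  fixes H :: "nat \<Rightarrow> matrix measure" and d :: "nat \<Rightarrow> nat" and l :: "nat \<Rightarrow> real"
  assumes haar: "\<And>k. haar_orthogonal k (H k)"
    and params: "admissible d l"
    and heuristic: "\<And>d' l'. admissible d' l' \<Longrightarrow>
          hidden_sample_heuristic (\<lambda>n. sync_dim n (d' n))
            (\<lambda>n. planted_law H n (d' n) (l' n)) (\<lambda>n. null_law n (d' n))"
  shows "\<nexists>A \<epsilon>. \<epsilon> \<longlonglongrightarrow> 0 \<and>
           (\<forall>\<^sub>F n in sequentially. runs_in_time (sync_dim n (d n)) (A n) (exp (real n powr \<epsilon> n))) \<and>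
           weak_recovery H d l A"
proof
  assume "\<exists>A \<epsilon>. \<epsilon> \<longlonglongrightarrow> 0 \<and>
           (\<forall>\<^sub>F n in sequentially. runs_in_time (sync_dim n (d n)) (A n) (exp (real n powr \<epsilon> n))) \<and>
           weak_recovery H d l A"
  then obtain A c where "0 < c" and rec: "\<forall>\<^sub>F n in sequentially.
        (\<integral>((V, g), w).
            cosine (sync_dim n (d n))
              (final (sync_dim n (d n)) (A n) (observation n (d n) (l n) V g) w)
              (signal n (d n) (l n) V)
          \<partial>(sync_space H n (d n) \<Otimes>\<^sub>M tape)) \<ge> c"
    unfolding weak_recovery_def by blast
  obtain \<delta> where d: "\<And>n. 1 \<le> d n" and l: "\<And>n. 0 < l n" "\<And>n. l n < 1 - \<delta>" and "0 < \<delta>"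
    using params by (auto simp: admissible_def)
  obtain \<epsilon> where "\<epsilon> \<longlonglongrightarrow> 0" and eps: "\<forall>\<^sub>F n in sequentially. real (d n) = real n powr \<epsilon> n"
    using params by (auto simp: admissible_def)
  have "\<delta> < 1"
    using l[of 0] by simp
  \<comment> \<open>\<open>r\<close> is the midpoint of (1 - \<delta>)^2 and 1, and \<eta> is chosen
    so that (1 - \<delta>)^2 + 2 \<eta>^2 = r.\<close>
  define r where "r = (1 + (1 - \<delta>)\<^sup>2) / 2"
  define \<eta> where "\<eta> = sqrt ((1 - (1 - \<delta>)\<^sup>2) / 4)"
  have \<delta>2: "(1 - \<delta>)\<^sup>2 < 1"
    using \<open>0 < \<delta>\<close> \<open>\<delta> < 1\<close> by (simp add: power_less_one_iff)
  then have "0 < \<eta>" and \<eta>2: "\<eta>\<^sup>2 = (1 - (1 - \<delta>)\<^sup>2) / 4" and "r < 1" "0 < r"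
    by (auto simp: \<eta>_def r_def add_pos_nonneg)
  define \<Lambda> where "\<Lambda> = ln (1 / sqrt (1 - r))"
  have exp_\<Lambda>: "exp \<Lambda> = 1 / sqrt (1 - r)"
    using \<open>r < 1\<close> by (simp add: \<Lambda>_def)
  have bound: "\<eta>\<^sup>2 * c\<^sup>2 / 2 * real n \<le> \<Lambda> * real (d n)"
    if "0 < n" and rec: "c \<le> (\<integral>((V, g), w).
            cosine (sync_dim n (d n))
              (final (sync_dim n (d n)) (A n) (observation n (d n) (l n) V g) w)
              (signal n (d n) (l n) V)
          \<partial>(sync_space H n (d n) \<Otimes>\<^sub>M tape))" for n
  proof -
    \<comment> \<open>With this choice s l = \<eta>, so the extra observation has the same strength
      for every \<open>n\<close>, however small \<open>l n\<close> is.\<close>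
    define s where "s = \<eta> / l n"
    \<comment> \<open>The minimizer of 2 t^2 - 2 t \<eta> sqrt (n d) c; at it the linear term is 4
      t^2, twice the quadratic one.\<close>
    define t where "t = \<eta> * sqrt (real n * real (d n)) * c / 2"
    have "(l n)\<^sup>2 \<le> (1 - \<delta>)\<^sup>2"
      using l[of n] by (intro power_mono) auto
    moreover have "(l n)\<^sup>2 * (1 + 2 * s\<^sup>2) = (l n)\<^sup>2 + 2 * \<eta>\<^sup>2"
      using l(1)[of n] by (simp add: s_def field_simps)
    ultimately have r': "(l n)\<^sup>2 * (1 + 2 * s\<^sup>2) \<le> r"
      by (simp add: r_def \<eta>2 field_simps)
    have "exp (2 * t * s * l n * sqrt (real n * real (d n)) * c) \<le>
        exp (2 * t\<^sup>2) * (1 / sqrt (1 - (l n)\<^sup>2 * (1 + 2 * s\<^sup>2))) ^ (d n)\<^sup>2"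
      using that d[of n] l(1)[of n] \<open>0 < \<eta>\<close> \<open>0 < c\<close> r' \<open>r < 1\<close>
      by (intro cosine_bound_nonasymptotic[OF haar]) (auto simp: s_def t_def sync_space_def)
    also have "\<dots> \<le> exp (2 * t\<^sup>2) * (exp \<Lambda>) ^ (d n)\<^sup>2"
      using r' \<open>r < 1\<close> unfolding exp_\<Lambda> by (intro mult_left_mono power_mono divide_left_mono) auto
    also have "\<dots> = exp (2 * t\<^sup>2 + (real (d n))\<^sup>2 * \<Lambda>)"
      by (simp add: exp_add exp_of_nat_mult[symmetric])
    finally have "2 * t * s * l n * sqrt (real n * real (d n)) * c \<le> 2 * t\<^sup>2 + (real (d n))\<^sup>2 * \<Lambda>"
      by simp
    moreover have "2 * t * s * l n * sqrt (real n * real (d n)) * c = 4 * t\<^sup>2"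
      using l(1)[of n] by (simp add: s_def t_def power2_eq_square)
    moreover have "2 * t\<^sup>2 = \<eta>\<^sup>2 * c\<^sup>2 / 2 * real n * real (d n)"
      by (simp add: t_def power_mult_distrib power_divide)
    ultimately have "\<eta>\<^sup>2 * c\<^sup>2 / 2 * real n * real (d n) \<le> (real (d n))\<^sup>2 * \<Lambda>"
      by linarith
    then have "(\<eta>\<^sup>2 * c\<^sup>2 / 2 * real n) * real (d n) \<le> (\<Lambda> * real (d n)) * real (d n)"
      by (simp add: power2_eq_square ac_simps)
    then show ?thesis
      using d[of n] by (subst (asm) mult_le_cancel_right_pos) auto
  qed
  \<comment> \<open>In terms of \<open>C\<close> the bound reads n <= C d, whereas d = n powr
    \<epsilon> is eventually at most sqrt n; these collide once sqrt n exceeds \<open>C\<close>. The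
    maximum with 0 below supplies the nonnegative factor needed for monotonicity.\<close>
  define C where "C = \<Lambda> / (\<eta>\<^sup>2 * c\<^sup>2 / 2)"
  have "0 < \<eta>\<^sup>2 * c\<^sup>2 / 2"
    using \<open>0 < \<eta>\<close> \<open>0 < c\<close> by simp
  have "\<forall>\<^sub>F n in sequentially. (max 0 C)\<^sup>2 < real n"
    using filterlim_real_sequentially by (simp add: filterlim_at_top_dense)
  then have large: "\<forall>\<^sub>F n in sequentially. max 0 C < real n powr (1 / 2)"
    by eventually_elim (simp add: powr_half_sqrt real_less_rsqrt del: max_less_iff_conj)
  have small: "\<forall>\<^sub>F n in sequentially. \<epsilon> n < 1 / 2"
    using \<open>\<epsilon> \<longlonglongrightarrow> 0\<close> by (rule order_tendstoD) simp
  have "\<forall>\<^sub>F n in sequentially. False"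
    using rec eps large small eventually_gt_at_top[of 0]
  proof eventually_elim
    case (elim n)
    have "real n powr (1 / 2) * real n powr (1 / 2) = real n"
      using elim by (simp add: powr_add[symmetric])
    moreover have "real (d n) \<le> real n powr (1 / 2)"
      using elim by (simp add: powr_mono)
    moreover have "real n \<le> C * real (d n)"
      using bound[of n] elim \<open>0 < \<eta>\<^sup>2 * c\<^sup>2 / 2\<close> by (simp add: C_def field_simps)
    moreover have "C * real (d n) \<le> max 0 C * real n powr (1 / 2)"
      using \<open>real (d n) \<le> real n powr (1 / 2)\<close> by (intro mult_mono) auto
    moreover have "max 0 C * real n powr (1 / 2) < real n powr (1 / 2) * real n powr (1 / 2)"
      using elim by (intro mult_strict_right_mono) auto
    ultimately show False
      by linarith
  qed
  then show False
    by simp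
qed

end
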